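(* Let $\mathcal K$ be a $2$-category. 1. Let $(c_i)_{i\in J}$ be a family of objects of $\mathcal K$ whose product $c=\prod_{i\in J}c_i$ exists in $\mathcal K$. Then the family of projections $(\pi_i\colon c\to c_i)_{i\in J}$ preserves and jointly strictly creates all right and left Kan extensions. 2. Let $f,g\colon a\to b$ be $1$-cells whose inserter $(\mathrm{Ins}(f,g),\ u\colon\mathrm{Ins}(f,g)\to a,\ \phi\colon fu\Rightarrow gu)$ exists in $\mathcal K$. Then $u$ strictly creates left Kan extensions that $f$ preserves, and right Kan extensions that $g$ preserves. That is, for every span $K\xleftarrow{k}I\xrightarrow{d}\mathrm{Ins}(f,g)$: if $f$ preserves the left Kan extension of $ud$ along $k$, then $u$ strictly creates the left Kan extension of $d$ along $k$; and if $g$ preserves the right Kan extension of $ud$ along $k$, then $u$ strictly creates the right Kan extension of $d$ along $k$. 3. Let $u\colon\mathrm{Eq}(\eta,\theta)\to c$ be the equifier of $2$-cells $\eta,\theta\colon f\Rightarrow g\colon c\to c'$ in $\mathcal K$. Then $u$ strictly creates left (right) Kan extensions whose quotient initiality (subterminality) is preserved by $f$ (by $g$). That is, for every span $K\xleftarrow{k}I\xrightarrow{d}\mathrm{Eq}(\eta,\theta)$: if $f_*\colon\mathrm{LE}(ud,k)\to\mathrm{LE}(fud,k)$ sends initial objects to quotient initial objects, then $u$ strictly creates the left Kan extension of $d$ along $k$; and if $g_*\colon\mathrm{RE}(ud,k)\to\mathrm{RE}(gud,k)$ sends terminal objects to subterminal objects, then $u$ strictly creates the right Kan extension of $d$ along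 $k$.
   Context: A 2-category is strict; $\bullet$ is vertical composition of 2-cells, juxtaposition is composition of 1-cells, $*$ is horizontal composition of 2-cells, and in whiskerings a 1-cell $h$ stands for $\mathrm{id}_h$. All 2-limits are strict. Product $\prod_i c_i$ with projections $\pi_i$: families of 1-cells $x\to c_i$, resp. of 2-cells between such, correspond uniquely to 1-cells $x\to\prod_i c_i$, resp. 2-cells. Inserter of $f,g\colon a\to b$: an object $\mathrm{Ins}(f,g)$ with a 1-cell $u\colon\mathrm{Ins}(f,g)\to a$ and a 2-cell $\phi\colon fu\Rightarrow gu$ such that (i) for each $h'\colon x\to a$ and $\alpha\colon fh'\Rightarrow gh'$ there is a unique $h$ with $h'=uh$, $\alpha=\phi*h$; (ii) for $h_1,h_2\colon x\to\mathrm{Ins}(f,g)$ and $\alpha'\colon uh_1\Rightarrow uh_2$ with $(g*\alpha')\bullet(\phi*h_1)=(\phi*h_2)\bullet(f*\alpha')$ there is a unique $\alpha\colon h_1\Rightarrow h_2$ with $\alpha'=u*\alpha$. Equifier of $\eta,\theta\colon f\Rightarrow g\colon c\to c'$: an object $\mathrm{Eq}(\eta,\theta)$ with a 1-cell $u\colon\mathrm{Eq}(\eta,\theta)\to c$, $\eta*u=\theta*u$, such that every $h'\colon x\to c$ with $\eta*h'=\theta*h'$ factors uniquely as $h'=uh$, and $u*(-)\colon\mathcal K(x,\mathrm{Eq}(\eta,\theta))\to\mathcal K(x,c)$ is fully faithful for all $x$. An object $c$ of a category is quotient initial if for every object $c'$ there is at most one morphism $c\to c'$; subterminal objects are defined dually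 (at most one morphism $c'\to c$ for each $c'$). Kan extensions. For 1-cells $K\xleftarrow{k}I\xrightarrow{d}c$, let $k^*\colon\mathcal K(K,c)\to\mathcal K(I,c)$ be precomposition with $k$. $\mathrm{LE}(d,k)$ is the comma category $d\downarrow k^*$: its objects are pairs $(l\colon K\to c,\ \varepsilon\colon d\Rightarrow lk)$, and morphisms $(l,\varepsilon)\to(l',\varepsilon')$ are 2-cells $\lambda\colon l\Rightarrow l'$ with $(\lambda*k)\bullet\varepsilon=\varepsilon'$. Its initial objects are the left Kan extensions of $d$ along $k$. Dually $\mathrm{RE}(d,k)=k^*\downarrow d$ (objects $(r\colon K\to c,\ rk\Rightarrow d)$), whose terminal objects are the right Kan extensions of $d$ along $k$. A family of functors $(H_i\colon\mathcal C\to\mathcal D_i)_{i\in J}$ preserves initial objects if each $H_i$ sends initial objects to initial objects; it jointly strictly creates initial objects if for every initial object $(d_i)_i$ of $\prod_i\mathcal D_i$ there is a unique object $x$ of $\mathcal C$ with $H_ix=d_i$ for all $i$, and moreover $x$ is initial. For a one-element family one says "strictly creates". Dually for terminal objects. A 1-cell $f\colon c\to c'$ preserves (strictly creates) the left Kan extension of $d\colon I\to c$ along $k$ if the functor $f_*\colon\mathrm{LE}(d,k)\to\mathrm{LE}(fd,k)$, $(l,\varepsilon)\mapsto(fl,f*\varepsilon)$, preserves (strictly creates) initial objects; a family $(f_i\colon c\to d_i)_i$ jointly strictly creates it if the family $((f_i)_* )_i$ of functors jointly strictly creates initial objects. Dually for right Kan extensions with $\mathrm{RE}$ and terminal objects.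 *)

theory Defs
  imports Main "HOL-Library.FuncSet"
begin

section \<open>Categories and functors\<close>

text \<open>Hom-sets are indexed by pairs of objects and are not required to be disjoint.
  \<open>Id\<close>, \<open>Hom\<close> and \<open>Comp\<close> are only meaningful on objects and composable morphisms.\<close>

record ('o, 'm) cat =
  Obj :: "'o set"
  Hom :: "'o \<Rightarrow> 'o \<Rightarrow> 'm set"
  Id :: "'o \<Rightarrow> 'm"
  Comp :: "'m \<Rightarrow> 'm \<Rightarrow> 'm"

locale category =
  fixes C :: "('o, 'm) cat"
  assumes Id_in: "x \<in> Obj C \<Longrightarrow> Id C x \<in> Hom C x x"
    and Comp_in: "\<lbrakk>x \<in> Obj C; y \<in> Obj C; z \<in> Obj C; f \<in> Hom C x y; g \<in> Hom C y z\<rbrakk>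
      \<Longrightarrow> Comp C g f \<in> Hom C x z"
    and Comp_Id: "\<lbrakk>x \<in> Obj C; y \<in> Obj C; f \<in> Hom C x y\<rbrakk> \<Longrightarrow> Comp C f (Id C x) = f"
    and Id_Comp: "\<lbrakk>x \<in> Obj C; y \<in> Obj C; f \<in> Hom C x y\<rbrakk> \<Longrightarrow> Comp C (Id C y) f = f"
    and Comp_assoc: "\<lbrakk>w \<in> Obj C; x \<in> Obj C; y \<in> Obj C; z \<in> Obj C;
        f \<in> Hom C w x; g \<in> Hom C x y; h \<in> Hom C y z\<rbrakk>
      \<Longrightarrow> Comp C h (Comp C g f) = Comp C (Comp C h g) f"

record ('o1, 'm1, 'o2, 'm2) fctr =
  on_obj :: "'o1 \<Rightarrow> 'o2"
  on_mor :: "'m1 \<Rightarrow> 'm2"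

definition is_functor ::
    "('o1, 'm1) cat \<Rightarrow> ('o2, 'm2) cat \<Rightarrow> ('o1, 'm1, 'o2, 'm2) fctr \<Rightarrow> bool" where
  "is_functor C D H \<longleftrightarrow>
    category C \<and> category D \<and>
    (\<forall>x\<in>Obj C. on_obj H x \<in> Obj D) \<and>
    (\<forall>x\<in>Obj C. \<forall>y\<in>Obj C. \<forall>f\<in>Hom C x y.
       on_mor H f \<in> Hom D (on_obj H x) (on_obj H y)) \<and>
    (\<forall>x\<in>Obj C. on_mor H (Id C x) = Id D (on_obj H x)) \<and>
    (\<forall>x\<in>Obj C. \<forall>y\<in>Obj C. \<forall>z\<in>Obj C. \<forall>f\<in>Hom C x y. \<forall>g\<in>Hom C y z.
       on_mor H (Comp C g f) = Comp D (on_mor H g) (on_mor H f))"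

definition fully_faithful ::
    "('o1, 'm1) cat \<Rightarrow> ('o2, 'm2) cat \<Rightarrow> ('o1, 'm1, 'o2, 'm2) fctr \<Rightarrow> bool" where
  "fully_faithful C D H \<longleftrightarrow>
    (\<forall>x\<in>Obj C. \<forall>y\<in>Obj C. bij_betw (on_mor H) (Hom C x y) (Hom D (on_obj H x) (on_obj H y)))"

text \<open>Objects and morphisms of a product category are extensional families on \<open>J\<close>, so that
  equality of families is equality of functions.\<close>

definition prod_cat :: "'i set \<Rightarrow> ('i \<Rightarrow> ('o, 'm) cat) \<Rightarrow> ('i \<Rightarrow> 'o, 'i \<Rightarrow> 'm) cat" where
  "prod_cat J D =
    \<lparr>Obj = (\<Pi>\<^sub>E i\<in>J. Obj (D i)),
     Hom = (\<lambda>x y. \<Pi>\<^sub>E i\<in>J. Hom (D i) (x i) (y i)),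
     Id = (\<lambda>x. \<lambda>i\<in>J. Id (D i) (x i)),
     Comp = (\<lambda>g f. \<lambda>i\<in>J. Comp (D i) (g i) (f i))\<rparr>"

definition initial_obj :: "('o, 'm) cat \<Rightarrow> 'o \<Rightarrow> bool" where
  "initial_obj C c \<longleftrightarrow> c \<in> Obj C \<and> (\<forall>c'\<in>Obj C. \<exists>!m. m \<in> Hom C c c')"

definition terminal_obj :: "('o, 'm) cat \<Rightarrow> 'o \<Rightarrow> bool" where
  "terminal_obj C c \<longleftrightarrow> c \<in> Obj C \<and> (\<forall>c'\<in>Obj C. \<exists>!m. m \<in> Hom C c' c)"

definition quotient_initial :: "('o, 'm) cat \<Rightarrow> 'o \<Rightarrow> bool" where
  "quotient_initial C c \<longleftrightarrow>
    c \<in> Obj C \<and> (\<forall>c'\<in>Obj C. \<forall>m\<in>Hom C c c'. \<forall>n\<in>Hom C c c'. m = n)"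

definition subterminal :: "('o, 'm) cat \<Rightarrow> 'o \<Rightarrow> bool" where
  "subterminal C c \<longleftrightarrow>
    c \<in> Obj C \<and> (\<forall>c'\<in>Obj C. \<forall>m\<in>Hom C c' c. \<forall>n\<in>Hom C c' c. m = n)"

definition preserves_initial ::
    "('o1, 'm1) cat \<Rightarrow> 'i set \<Rightarrow> ('i \<Rightarrow> ('o2, 'm2) cat) \<Rightarrow>
      ('i \<Rightarrow> ('o1, 'm1, 'o2, 'm2) fctr) \<Rightarrow> bool" where
  "preserves_initial C J D H \<longleftrightarrow>
    (\<forall>i\<in>J. \<forall>x. initial_obj C x \<longrightarrow> initial_obj (D i) (on_obj (H i) x))"

definition preserves_terminal ::
    "('o1, 'm1) cat \<Rightarrow> 'i set \<Rightarrow> ('i \<Rightarrow> ('o2, 'm2) cat) \<Rightarrow>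
      ('i \<Rightarrow> ('o1, 'm1, 'o2, 'm2) fctr) \<Rightarrow> bool" where
  "preserves_terminal C J D H \<longleftrightarrow>
    (\<forall>i\<in>J. \<forall>x. terminal_obj C x \<longrightarrow> terminal_obj (D i) (on_obj (H i) x))"

definition jointly_strictly_creates_initial ::
    "('o1, 'm1) cat \<Rightarrow> 'i set \<Rightarrow> ('i \<Rightarrow> ('o2, 'm2) cat) \<Rightarrow>
      ('i \<Rightarrow> ('o1, 'm1, 'o2, 'm2) fctr) \<Rightarrow> bool" where
  "jointly_strictly_creates_initial C J D H \<longleftrightarrow>
    (\<forall>d. initial_obj (prod_cat J D) d \<longrightarrow>
      (\<exists>!x. x \<in> Obj C \<and> (\<forall>i\<in>J. on_obj (H i) x = d i)) \<and>
      (\<forall>x. x \<in> Obj C \<and> (\<forall>i\<in>J. on_obj (H i) x = d i) \<longrightarrow> initial_obj C x))"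

definition jointly_strictly_creates_terminal ::
    "('o1, 'm1) cat \<Rightarrow> 'i set \<Rightarrow> ('i \<Rightarrow> ('o2, 'm2) cat) \<Rightarrow>
      ('i \<Rightarrow> ('o1, 'm1, 'o2, 'm2) fctr) \<Rightarrow> bool" where
  "jointly_strictly_creates_terminal C J D H \<longleftrightarrow>
    (\<forall>d. terminal_obj (prod_cat J D) d \<longrightarrow>
      (\<exists>!x. x \<in> Obj C \<and> (\<forall>i\<in>J. on_obj (H i) x = d i)) \<and>
      (\<forall>x. x \<in> Obj C \<and> (\<forall>i\<in>J. on_obj (H i) x = d i) \<longrightarrow> terminal_obj C x))"


section \<open>Strict 2-categories\<close>

text \<open>Composition is written in function order: \<open>g \<cdot> f\<close> and \<open>\<beta> \<star> \<alpha>\<close> (horizontal)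
  require \<open>f\<close>, \<open>\<alpha>\<close> to come first, and \<open>\<beta> \<bullet> \<alpha>\<close> (vertical) is \<open>\<beta>\<close> after \<open>\<alpha>\<close>.
  Whiskering with a 1-cell \<open>h\<close> is horizontal composition with \<open>id2 h\<close>.\<close>

record ('o, 'a, 'b) two_cat =
  Cell0 :: "'o set"
  Cell1 :: "'a set"
  Cell2 :: "'b set"
  dom1 :: "'a \<Rightarrow> 'o"
  cod1 :: "'a \<Rightarrow> 'o"
  dom2 :: "'b \<Rightarrow> 'a"
  cod2 :: "'b \<Rightarrow> 'a"
  id1 :: "'o \<Rightarrow> 'a"
  id2 :: "'a \<Rightarrow> 'b"
  comp1 :: "'a \<Rightarrow> 'a \<Rightarrow> 'a"  (infixl "\<cdot>\<index>" 75)
  vcomp :: "'b \<Rightarrow> 'b \<Rightarrow> 'b"  (infixl "\<bullet>\<index>" 65)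
  hcomp :: "'b \<Rightarrow> 'b \<Rightarrow> 'b"  (infixl "\<star>\<index>" 70)

definition hom1 :: "('o, 'a, 'b) two_cat \<Rightarrow> 'o \<Rightarrow> 'o \<Rightarrow> 'a set" where
  "hom1 \<K> x y = {f \<in> Cell1 \<K>. dom1 \<K> f = x \<and> cod1 \<K> f = y}"

definition hom2 :: "('o, 'a, 'b) two_cat \<Rightarrow> 'a \<Rightarrow> 'a \<Rightarrow> 'b set" where
  "hom2 \<K> f g = {\<alpha> \<in> Cell2 \<K>. dom2 \<K> \<alpha> = f \<and> cod2 \<K> \<alpha> = g}"

locale two_category =
  fixes \<K> :: "('o, 'a, 'b) two_cat" (structure)
  assumes dom1_in: "f \<in> Cell1 \<K> \<Longrightarrow> dom1 \<K> f \<in> Cell0 \<K>"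
    and cod1_in: "f \<in> Cell1 \<K> \<Longrightarrow> cod1 \<K> f \<in> Cell0 \<K>"
    and dom2_in: "\<alpha> \<in> Cell2 \<K> \<Longrightarrow> dom2 \<K> \<alpha> \<in> Cell1 \<K>"
    and cod2_in: "\<alpha> \<in> Cell2 \<K> \<Longrightarrow> cod2 \<K> \<alpha> \<in> Cell1 \<K>"
    and dom1_cod2: "\<alpha> \<in> Cell2 \<K> \<Longrightarrow> dom1 \<K> (cod2 \<K> \<alpha>) = dom1 \<K> (dom2 \<K> \<alpha>)"
    and cod1_cod2: "\<alpha> \<in> Cell2 \<K> \<Longrightarrow> cod1 \<K> (cod2 \<K> \<alpha>) = cod1 \<K> (dom2 \<K> \<alpha>)"
    and id1_in: "x \<in> Cell0 \<K> \<Longrightarrow> id1 \<K> x \<in> hom1 \<K> x x"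
    and comp1_in: "\<lbrakk>f \<in> hom1 \<K> x y; g \<in> hom1 \<K> y z\<rbrakk> \<Longrightarrow> g \<cdot> f \<in> hom1 \<K> x z"
    and comp1_id1: "f \<in> hom1 \<K> x y \<Longrightarrow> f \<cdot> id1 \<K> x = f"
    and id1_comp1: "f \<in> hom1 \<K> x y \<Longrightarrow> id1 \<K> y \<cdot> f = f"
    and comp1_assoc: "\<lbrakk>f \<in> hom1 \<K> w x; g \<in> hom1 \<K> x y; h \<in> hom1 \<K> y z\<rbrakk>
      \<Longrightarrow> h \<cdot> (g \<cdot> f) = (h \<cdot> g) \<cdot> f"
    and id2_in: "f \<in> Cell1 \<K> \<Longrightarrow> id2 \<K> f \<in> hom2 \<K> f f"
    and vcomp_in: "\<lbrakk>\<alpha> \<in> hom2 \<K> f g; \<beta> \<in> hom2 \<K> g h\<rbrakk> \<Longrightarrow> \<beta> \<bullet> \<alpha> \<in> hom2 \<K> f h"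
    and vcomp_id2: "\<alpha> \<in> hom2 \<K> f g \<Longrightarrow> \<alpha> \<bullet> id2 \<K> f = \<alpha>"
    and id2_vcomp: "\<alpha> \<in> hom2 \<K> f g \<Longrightarrow> id2 \<K> g \<bullet> \<alpha> = \<alpha>"
    and vcomp_assoc: "\<lbrakk>\<alpha> \<in> hom2 \<K> e f; \<beta> \<in> hom2 \<K> f g; \<gamma> \<in> hom2 \<K> g h\<rbrakk>
      \<Longrightarrow> \<gamma> \<bullet> (\<beta> \<bullet> \<alpha>) = (\<gamma> \<bullet> \<beta>) \<bullet> \<alpha>"
    and hcomp_in: "\<lbrakk>f \<in> hom1 \<K> x y; g \<in> hom1 \<K> y z; \<alpha> \<in> hom2 \<K> f f'; \<beta> \<in> hom2 \<K> g g'\<rbrakk>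
      \<Longrightarrow> \<beta> \<star> \<alpha> \<in> hom2 \<K> (g \<cdot> f) (g' \<cdot> f')"
    and hcomp_id2_id1: "\<lbrakk>f \<in> hom1 \<K> x y; \<alpha> \<in> hom2 \<K> f f'\<rbrakk> \<Longrightarrow> \<alpha> \<star> id2 \<K> (id1 \<K> x) = \<alpha>"
    and id2_id1_hcomp: "\<lbrakk>f \<in> hom1 \<K> x y; \<alpha> \<in> hom2 \<K> f f'\<rbrakk> \<Longrightarrow> id2 \<K> (id1 \<K> y) \<star> \<alpha> = \<alpha>"
    and hcomp_assoc: "\<lbrakk>f \<in> hom1 \<K> w x; g \<in> hom1 \<K> x y; h \<in> hom1 \<K> y z;
        \<alpha> \<in> hom2 \<K> f f'; \<beta> \<in> hom2 \<K> g g'; \<gamma> \<in> hom2 \<K> h h'\<rbrakk>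
      \<Longrightarrow> \<gamma> \<star> (\<beta> \<star> \<alpha>) = (\<gamma> \<star> \<beta>) \<star> \<alpha>"
    and id2_hcomp_id2: "\<lbrakk>f \<in> hom1 \<K> x y; g \<in> hom1 \<K> y z\<rbrakk>
      \<Longrightarrow> id2 \<K> g \<star> id2 \<K> f = id2 \<K> (g \<cdot> f)"
    and interchange: "\<lbrakk>f \<in> hom1 \<K> x y; g \<in> hom1 \<K> y z;
        \<alpha> \<in> hom2 \<K> f f'; \<alpha>' \<in> hom2 \<K> f' f''; \<beta> \<in> hom2 \<K> g g'; \<beta>' \<in> hom2 \<K> g' g''\<rbrakk>
      \<Longrightarrow> (\<beta>' \<bullet> \<beta>) \<star> (\<alpha>' \<bullet> \<alpha>) = (\<beta>' \<star> \<alpha>') \<bullet> (\<beta> \<star> \<alpha>)"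

definition hom_cat :: "('o, 'a, 'b) two_cat \<Rightarrow> 'o \<Rightarrow> 'o \<Rightarrow> ('a, 'b) cat" where
  "hom_cat \<K> x y = \<lparr>Obj = hom1 \<K> x y, Hom = hom2 \<K>, Id = id2 \<K>, Comp = vcomp \<K>\<rparr>"

text \<open>The functor \<open>u * (-)\<close> from \<open>hom_cat \<K> x y\<close> to \<open>hom_cat \<K> x z\<close>, for \<open>u : y \<rightarrow> z\<close>.\<close>

definition postcomp :: "('o, 'a, 'b) two_cat \<Rightarrow> 'a \<Rightarrow> ('a, 'b, 'a, 'b) fctr" where
  "postcomp \<K> u =
    \<lparr>on_obj = (\<lambda>h. u \<cdot>\<^bsub>\<K>\<^esub> h), on_mor = (\<lambda>\<alpha>. id2 \<K> u \<star>\<^bsub>\<K>\<^esub> \<alpha>)\<rparr>"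


section \<open>Strict 2-limits\<close>

definition is_product ::
    "('o, 'a, 'b) two_cat \<Rightarrow> 'i set \<Rightarrow> ('i \<Rightarrow> 'o) \<Rightarrow> 'o \<Rightarrow> ('i \<Rightarrow> 'a) \<Rightarrow> bool" where
  "is_product \<K> J cs c \<pi> \<longleftrightarrow>
    c \<in> Cell0 \<K> \<and>
    (\<forall>i\<in>J. cs i \<in> Cell0 \<K> \<and> \<pi> i \<in> hom1 \<K> c (cs i)) \<and>
    (\<forall>x\<in>Cell0 \<K>. \<forall>h. (\<forall>i\<in>J. h i \<in> hom1 \<K> x (cs i)) \<longrightarrow>
      (\<exists>!h'. h' \<in> hom1 \<K> x c \<and> (\<forall>i\<in>J. \<pi> i \<cdot>\<^bsub>\<K>\<^esub> h' = h i))) \<and>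
    (\<forall>x\<in>Cell0 \<K>. \<forall>h\<in>hom1 \<K> x c. \<forall>h'\<in>hom1 \<K> x c.
      \<forall>\<alpha>. (\<forall>i\<in>J. \<alpha> i \<in> hom2 \<K> (\<pi> i \<cdot>\<^bsub>\<K>\<^esub> h) (\<pi> i \<cdot>\<^bsub>\<K>\<^esub> h')) \<longrightarrow>
        (\<exists>!\<alpha>'. \<alpha>' \<in> hom2 \<K> h h' \<and> (\<forall>i\<in>J. id2 \<K> (\<pi> i) \<star>\<^bsub>\<K>\<^esub> \<alpha>' = \<alpha> i)))"

definition is_inserter ::
    "('o, 'a, 'b) two_cat \<Rightarrow> 'o \<Rightarrow> 'o \<Rightarrow> 'a \<Rightarrow> 'a \<Rightarrow> 'o \<Rightarrow> 'a \<Rightarrow> 'b \<Rightarrow> bool" where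
  "is_inserter \<K> a b f g e u \<phi> \<longleftrightarrow>
    f \<in> hom1 \<K> a b \<and> g \<in> hom1 \<K> a b \<and>
    e \<in> Cell0 \<K> \<and> u \<in> hom1 \<K> e a \<and> \<phi> \<in> hom2 \<K> (f \<cdot>\<^bsub>\<K>\<^esub> u) (g \<cdot>\<^bsub>\<K>\<^esub> u) \<and>
    (\<forall>x\<in>Cell0 \<K>. \<forall>h'\<in>hom1 \<K> x a. \<forall>\<alpha>\<in>hom2 \<K> (f \<cdot>\<^bsub>\<K>\<^esub> h') (g \<cdot>\<^bsub>\<K>\<^esub> h').
      \<exists>!h. h \<in> hom1 \<K> x e \<and> h' = u \<cdot>\<^bsub>\<K>\<^esub> h \<and> \<alpha> = \<phi> \<star>\<^bsub>\<K>\<^esub> id2 \<K> h) \<and>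
    (\<forall>x\<in>Cell0 \<K>. \<forall>h\<^sub>1\<in>hom1 \<K> x e. \<forall>h\<^sub>2\<in>hom1 \<K> x e.
      \<forall>\<alpha>'\<in>hom2 \<K> (u \<cdot>\<^bsub>\<K>\<^esub> h\<^sub>1) (u \<cdot>\<^bsub>\<K>\<^esub> h\<^sub>2).
        (id2 \<K> g \<star>\<^bsub>\<K>\<^esub> \<alpha>') \<bullet>\<^bsub>\<K>\<^esub> (\<phi> \<star>\<^bsub>\<K>\<^esub> id2 \<K> h\<^sub>1) =
        (\<phi> \<star>\<^bsub>\<K>\<^esub> id2 \<K> h\<^sub>2) \<bullet>\<^bsub>\<K>\<^esub> (id2 \<K> f \<star>\<^bsub>\<K>\<^esub> \<alpha>') \<longrightarrow>
        (\<exists>!\<alpha>. \<alpha> \<in> hom2 \<K> h\<^sub>1 h\<^sub>2 \<and> \<alpha>' = id2 \<K> u \<star>\<^bsub>\<K>\<^esub> \<alpha>))"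

definition is_equifier ::
    "('o, 'a, 'b) two_cat \<Rightarrow> 'o \<Rightarrow> 'o \<Rightarrow> 'a \<Rightarrow> 'a \<Rightarrow> 'b \<Rightarrow> 'b \<Rightarrow> 'o \<Rightarrow> 'a \<Rightarrow> bool" where
  "is_equifier \<K> c c' f g \<eta> \<theta> e u \<longleftrightarrow>
    f \<in> hom1 \<K> c c' \<and> g \<in> hom1 \<K> c c' \<and> \<eta> \<in> hom2 \<K> f g \<and> \<theta> \<in> hom2 \<K> f g \<and>
    e \<in> Cell0 \<K> \<and> u \<in> hom1 \<K> e c \<and> \<eta> \<star>\<^bsub>\<K>\<^esub> id2 \<K> u = \<theta> \<star>\<^bsub>\<K>\<^esub> id2 \<K> u \<and>
    (\<forall>x\<in>Cell0 \<K>. \<forall>h'\<in>hom1 \<K> x c. \<eta> \<star>\<^bsub>\<K>\<^esub> id2 \<K> h' = \<theta> \<star>\<^bsub>\<K>\<^esub> id2 \<K> h' \<longrightarrow>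
      (\<exists>!h. h \<in> hom1 \<K> x e \<and> h' = u \<cdot>\<^bsub>\<K>\<^esub> h)) \<and>
    (\<forall>x\<in>Cell0 \<K>. fully_faithful (hom_cat \<K> x e) (hom_cat \<K> x c) (postcomp \<K> u))"


section \<open>Kan extensions\<close>

text \<open>For a span \<open>K \<leftarrow> I \<rightarrow> c\<close> with legs \<open>k\<close> and \<open>d\<close>, the objects \<open>I\<close>, \<open>K\<close> and \<open>c\<close> are recovered
  as domains and codomains. The morphisms of \<open>LE\<close> and \<open>RE\<close> are bare 2-cells.\<close>

definition LE :: "('o, 'a, 'b) two_cat \<Rightarrow> 'a \<Rightarrow> 'a \<Rightarrow> ('a \<times> 'b, 'b) cat" where
  "LE \<K> d k =
    \<lparr>Obj = {(l, \<epsilon>). l \<in> hom1 \<K> (cod1 \<K> k) (cod1 \<K> d) \<and> \<epsilon> \<in> hom2 \<K> d (l \<cdot>\<^bsub>\<K>\<^esub> k)},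
     Hom = (\<lambda>(l, \<epsilon>) (l', \<epsilon>'). {\<xi> \<in> hom2 \<K> l l'. (\<xi> \<star>\<^bsub>\<K>\<^esub> id2 \<K> k) \<bullet>\<^bsub>\<K>\<^esub> \<epsilon> = \<epsilon>'}),
     Id = (\<lambda>(l, \<epsilon>). id2 \<K> l),
     Comp = vcomp \<K>\<rparr>"

definition RE :: "('o, 'a, 'b) two_cat \<Rightarrow> 'a \<Rightarrow> 'a \<Rightarrow> ('a \<times> 'b, 'b) cat" where
  "RE \<K> d k =
    \<lparr>Obj = {(r, \<epsilon>). r \<in> hom1 \<K> (cod1 \<K> k) (cod1 \<K> d) \<and> \<epsilon> \<in> hom2 \<K> (r \<cdot>\<^bsub>\<K>\<^esub> k) d},
     Hom = (\<lambda>(r, \<epsilon>) (r', \<epsilon>'). {\<xi> \<in> hom2 \<K> r r'. \<epsilon>' \<bullet>\<^bsub>\<K>\<^esub> (\<xi> \<star>\<^bsub>\<K>\<^esub> id2 \<K> k) = \<epsilon>}),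
     Id = (\<lambda>(r, \<epsilon>). id2 \<K> r),
     Comp = vcomp \<K>\<rparr>"

text \<open>The functor \<open>f\<^sub>*\<close>, used both from \<open>LE \<K> d k\<close> to \<open>LE \<K> (f \<cdot> d) k\<close> and from
  \<open>RE \<K> d k\<close> to \<open>RE \<K> (f \<cdot> d) k\<close>.\<close>

definition push :: "('o, 'a, 'b) two_cat \<Rightarrow> 'a \<Rightarrow> ('a \<times> 'b, 'b, 'a \<times> 'b, 'b) fctr" where
  "push \<K> f =
    \<lparr>on_obj = (\<lambda>(l, \<epsilon>). (f \<cdot>\<^bsub>\<K>\<^esub> l, id2 \<K> f \<star>\<^bsub>\<K>\<^esub> \<epsilon>)),
     on_mor = (\<lambda>\<xi>. id2 \<K> f \<star>\<^bsub>\<K>\<^esub> \<xi>)\<rparr>"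

definition family_preserves_left_kan ::
    "('o, 'a, 'b) two_cat \<Rightarrow> 'i set \<Rightarrow> ('i \<Rightarrow> 'a) \<Rightarrow> 'a \<Rightarrow> 'a \<Rightarrow> bool" where
  "family_preserves_left_kan \<K> J f d k \<longleftrightarrow>
    preserves_initial (LE \<K> d k) J (\<lambda>i. LE \<K> (f i \<cdot>\<^bsub>\<K>\<^esub> d) k) (\<lambda>i. push \<K> (f i))"

definition family_preserves_right_kan ::
    "('o, 'a, 'b) two_cat \<Rightarrow> 'i set \<Rightarrow> ('i \<Rightarrow> 'a) \<Rightarrow> 'a \<Rightarrow> 'a \<Rightarrow> bool" where
  "family_preserves_right_kan \<K> J f d k \<longleftrightarrow>
    preserves_terminal (RE \<K> d k) J (\<lambda>i. RE \<K> (f i \<cdot>\<^bsub>\<K>\<^esub> d) k) (\<lambda>i. push \<K> (f i))"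

definition jointly_strictly_creates_left_kan ::
    "('o, 'a, 'b) two_cat \<Rightarrow> 'i set \<Rightarrow> ('i \<Rightarrow> 'a) \<Rightarrow> 'a \<Rightarrow> 'a \<Rightarrow> bool" where
  "jointly_strictly_creates_left_kan \<K> J f d k \<longleftrightarrow>
    jointly_strictly_creates_initial
      (LE \<K> d k) J (\<lambda>i. LE \<K> (f i \<cdot>\<^bsub>\<K>\<^esub> d) k) (\<lambda>i. push \<K> (f i))"

definition jointly_strictly_creates_right_kan ::
    "('o, 'a, 'b) two_cat \<Rightarrow> 'i set \<Rightarrow> ('i \<Rightarrow> 'a) \<Rightarrow> 'a \<Rightarrow> 'a \<Rightarrow> bool" where
  "jointly_strictly_creates_right_kan \<K> J f d k \<longleftrightarrow>
    jointly_strictly_creates_terminal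
      (RE \<K> d k) J (\<lambda>i. RE \<K> (f i \<cdot>\<^bsub>\<K>\<^esub> d) k) (\<lambda>i. push \<K> (f i))"

text \<open>The versions for a single 1-cell are those for a family indexed by a one-element set.\<close>

definition preserves_left_kan ::
    "('o, 'a, 'b) two_cat \<Rightarrow> 'a \<Rightarrow> 'a \<Rightarrow> 'a \<Rightarrow> bool" where
  "preserves_left_kan \<K> f d k \<longleftrightarrow> family_preserves_left_kan \<K> {()} (\<lambda>_. f) d k"

definition preserves_right_kan ::
    "('o, 'a, 'b) two_cat \<Rightarrow> 'a \<Rightarrow> 'a \<Rightarrow> 'a \<Rightarrow> bool" where
  "preserves_right_kan \<K> f d k \<longleftrightarrow> family_preserves_right_kan \<K> {()} (\<lambda>_. f) d k"

definition strictly_creates_left_kan ::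
    "('o, 'a, 'b) two_cat \<Rightarrow> 'a \<Rightarrow> 'a \<Rightarrow> 'a \<Rightarrow> bool" where
  "strictly_creates_left_kan \<K> f d k \<longleftrightarrow>
    jointly_strictly_creates_left_kan \<K> {()} (\<lambda>_. f) d k"

definition strictly_creates_right_kan ::
    "('o, 'a, 'b) two_cat \<Rightarrow> 'a \<Rightarrow> 'a \<Rightarrow> 'a \<Rightarrow> bool" where
  "strictly_creates_right_kan \<K> f d k \<longleftrightarrow>
    jointly_strictly_creates_right_kan \<K> {()} (\<lambda>_. f) d k"

text \<open>\<open>f\<^sub>*\<close> sends the left Kan extensions of \<open>d\<close> along \<open>k\<close> to quotient initial objects of
  \<open>LE \<K> (f \<cdot> d) k\<close>, and dually.\<close>

definition preserves_quotient_initiality_of_left_kan ::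
    "('o, 'a, 'b) two_cat \<Rightarrow> 'a \<Rightarrow> 'a \<Rightarrow> 'a \<Rightarrow> bool" where
  "preserves_quotient_initiality_of_left_kan \<K> f d k \<longleftrightarrow>
    (\<forall>x. initial_obj (LE \<K> d k) x \<longrightarrow>
      quotient_initial (LE \<K> (f \<cdot>\<^bsub>\<K>\<^esub> d) k) (on_obj (push \<K> f) x))"

definition preserves_subterminality_of_right_kan ::
    "('o, 'a, 'b) two_cat \<Rightarrow> 'a \<Rightarrow> 'a \<Rightarrow> 'a \<Rightarrow> bool" where
  "preserves_subterminality_of_right_kan \<K> f d k \<longleftrightarrow>
    (\<forall>x. terminal_obj (RE \<K> d k) x \<longrightarrow>
      subterminal (RE \<K> (f \<cdot>\<^bsub>\<K>\<^esub> d) k) (on_obj (push \<K> f) x))"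


section \<open>Well-definedness\<close>

lemma category_prod_cat:
  assumes "\<And>i. i \<in> J \<Longrightarrow> category (D i)"
  shows "category (prod_cat J D)"
proof
  fix x assume "x \<in> Obj (prod_cat J D)"
  then show "Id (prod_cat J D) x \<in> Hom (prod_cat J D) x x"
    using category.Id_in[OF assms] by (auto simp: prod_cat_def)
next
  fix x y z f g
  assume "x \<in> Obj (prod_cat J D)" "y \<in> Obj (prod_cat J D)" "z \<in> Obj (prod_cat J D)"
    "f \<in> Hom (prod_cat J D) x y" "g \<in> Hom (prod_cat J D) y z"
  then show "Comp (prod_cat J D) g f \<in> Hom (prod_cat J D) x z"
    using category.Comp_in[OF assms] by (fastforce simp: prod_cat_def PiE_iff)
next
  fix x y f
  assume "x \<in> Obj (prod_cat J D)" "y \<in> Obj (prod_cat J D)" "f \<in> Hom (prod_cat J D) x y"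
  then show "Comp (prod_cat J D) f (Id (prod_cat J D) x) = f"
    using category.Comp_Id[OF assms]
    by (auto simp: prod_cat_def PiE_iff extensional_def fun_eq_iff)
next
  fix x y f
  assume "x \<in> Obj (prod_cat J D)" "y \<in> Obj (prod_cat J D)" "f \<in> Hom (prod_cat J D) x y"
  then show "Comp (prod_cat J D) (Id (prod_cat J D) y) f = f"
    using category.Id_Comp[OF assms]
    by (auto simp: prod_cat_def PiE_iff extensional_def fun_eq_iff)
next
  fix w x y z f g h
  assume *: "w \<in> Obj (prod_cat J D)" "x \<in> Obj (prod_cat J D)"
    "y \<in> Obj (prod_cat J D)" "z \<in> Obj (prod_cat J D)"
    "f \<in> Hom (prod_cat J D) w x" "g \<in> Hom (prod_cat J D) x y" "h \<in> Hom (prod_cat J D) y z"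
  have "Comp (D i) (h i) (Comp (D i) (g i) (f i)) = Comp (D i) (Comp (D i) (h i) (g i)) (f i)"
    if "i \<in> J" for i
    using * that
    by (intro category.Comp_assoc[OF assms, of i "w i" "x i" "y i" "z i"])
      (auto simp: prod_cat_def)
  then show "Comp (prod_cat J D) h (Comp (prod_cat J D) g f) =
      Comp (prod_cat J D) (Comp (prod_cat J D) h g) f"
    by (auto simp: prod_cat_def)
qed

context two_category
begin

lemma hom1_Cell1: "f \<in> hom1 \<K> x y \<Longrightarrow> f \<in> Cell1 \<K>"
  by (simp add: hom1_def)

lemma category_hom_cat: "category (hom_cat \<K> x y)"
  by standard (auto simp: hom_cat_def id2_in hom1_Cell1
      intro: vcomp_in vcomp_id2 id2_vcomp vcomp_assoc)

lemma whisker_right_vcomp: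
  assumes "k \<in> hom1 \<K> x y" "l \<in> hom1 \<K> y z" "\<alpha> \<in> hom2 \<K> l l'" "\<beta> \<in> hom2 \<K> l' l''"
  shows "(\<beta> \<bullet> \<alpha>) \<star> id2 \<K> k = (\<beta> \<star> id2 \<K> k) \<bullet> (\<alpha> \<star> id2 \<K> k)"
  using interchange[OF assms(1,2) id2_in id2_in assms(3,4)] assms(1)
    id2_vcomp[OF id2_in] by (simp add: hom1_Cell1)

lemma whisker_left_vcomp:
  assumes "l \<in> hom1 \<K> x y" "f \<in> hom1 \<K> y z" "\<alpha> \<in> hom2 \<K> l l'" "\<beta> \<in> hom2 \<K> l' l''"
  shows "id2 \<K> f \<star> (\<beta> \<bullet> \<alpha>) = (id2 \<K> f \<star> \<beta>) \<bullet> (id2 \<K> f \<star> \<alpha>)"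
  using interchange[OF assms(1,2,3,4) id2_in id2_in] assms(2)
    id2_vcomp[OF id2_in] by (simp add: hom1_Cell1)

lemma is_functor_postcomp:
  assumes "u \<in> hom1 \<K> y z"
  shows "is_functor (hom_cat \<K> x y) (hom_cat \<K> x z) (postcomp \<K> u)"
  using assms unfolding is_functor_def
  by (auto simp: category_hom_cat)
    (auto simp: hom_cat_def postcomp_def id2_hcomp_id2
      intro: comp1_in hcomp_in whisker_left_vcomp id2_in hom1_Cell1)

lemma category_LE:
  assumes k: "k \<in> hom1 \<K> I K" and d: "d \<in> hom1 \<K> I c"
  shows "category (LE \<K> d k)"
proof -
  have ck: "cod1 \<K> k = K" and cd: "cod1 \<K> d = c"
    using k d by (auto simp: hom1_def)
  have w: "\<xi> \<star> id2 \<K> k \<in> hom2 \<K> (l \<cdot> k) (l' \<cdot> k)"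
    if "l \<in> hom1 \<K> K c" "\<xi> \<in> hom2 \<K> l l'" for l l' \<xi>
    using hcomp_in[OF k that(1) id2_in that(2)] k by (simp add: hom1_Cell1)
  show ?thesis
  proof
    fix x assume "x \<in> Obj (LE \<K> d k)"
    then show "Id (LE \<K> d k) x \<in> Hom (LE \<K> d k) x x"
      using k by (auto simp: LE_def ck cd id2_in hom1_Cell1 id2_hcomp_id2 id2_vcomp)
  next
    fix x y z f g
    assume *: "x \<in> Obj (LE \<K> d k)" "y \<in> Obj (LE \<K> d k)" "z \<in> Obj (LE \<K> d k)"
      "f \<in> Hom (LE \<K> d k) x y" "g \<in> Hom (LE \<K> d k) y z"
    obtain l \<epsilon> l' \<epsilon>' l'' \<epsilon>'' where "x = (l, \<epsilon>)" "y = (l', \<epsilon>')" "z = (l'', \<epsilon>'')"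
      by (metis surj_pair)
    with * show "Comp (LE \<K> d k) g f \<in> Hom (LE \<K> d k) x z"
      using k by (auto simp: LE_def ck cd vcomp_in whisker_right_vcomp
          vcomp_assoc[OF _ w w, symmetric])
  qed (auto simp: LE_def vcomp_id2 id2_vcomp vcomp_assoc)
qed

lemma category_RE:
  assumes k: "k \<in> hom1 \<K> I K" and d: "d \<in> hom1 \<K> I c"
  shows "category (RE \<K> d k)"
proof -
  have ck: "cod1 \<K> k = K" and cd: "cod1 \<K> d = c"
    using k d by (auto simp: hom1_def)
  have w: "\<xi> \<star> id2 \<K> k \<in> hom2 \<K> (l \<cdot> k) (l' \<cdot> k)"
    if "l \<in> hom1 \<K> K c" "\<xi> \<in> hom2 \<K> l l'" for l l' \<xi>
    using hcomp_in[OF k that(1) id2_in that(2)] k by (simp add: hom1_Cell1)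
  show ?thesis
  proof
    fix x assume "x \<in> Obj (RE \<K> d k)"
    then show "Id (RE \<K> d k) x \<in> Hom (RE \<K> d k) x x"
      using k by (auto simp: RE_def ck cd id2_in hom1_Cell1 id2_hcomp_id2 vcomp_id2)
  next
    fix x y z f g
    assume *: "x \<in> Obj (RE \<K> d k)" "y \<in> Obj (RE \<K> d k)" "z \<in> Obj (RE \<K> d k)"
      "f \<in> Hom (RE \<K> d k) x y" "g \<in> Hom (RE \<K> d k) y z"
    obtain l \<epsilon> l' \<epsilon>' l'' \<epsilon>'' where "x = (l, \<epsilon>)" "y = (l', \<epsilon>')" "z = (l'', \<epsilon>'')"
      by (metis surj_pair)
    with * show "Comp (RE \<K> d k) g f \<in> Hom (RE \<K> d k) x z"
      using k by (auto simp: RE_def ck cd vcomp_in whisker_right_vcomp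
          vcomp_assoc[OF w w])
  qed (auto simp: RE_def vcomp_id2 id2_vcomp vcomp_assoc)
qed

lemma is_functor_push_LE:
  assumes k: "k \<in> hom1 \<K> I K" and d: "d \<in> hom1 \<K> I c" and f: "f \<in> hom1 \<K> c c'"
  shows "is_functor (LE \<K> d k) (LE \<K> (f \<cdot> d) k) (push \<K> f)"
proof -
  have fd: "f \<cdot> d \<in> hom1 \<K> I c'" using d f by (rule comp1_in)
  have cs: "cod1 \<K> k = K" "cod1 \<K> d = c" "cod1 \<K> (f \<cdot> d) = c'"
    using k d fd by (auto simp: hom1_def)
  have f2: "id2 \<K> f \<in> hom2 \<K> f f" and k2: "id2 \<K> k \<in> hom2 \<K> k k"
    using f k by (auto intro: id2_in hom1_Cell1)
  have w: "\<xi> \<star> id2 \<K> k \<in> hom2 \<K> (l \<cdot> k) (l' \<cdot> k)"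
    if "l \<in> hom1 \<K> K c" "\<xi> \<in> hom2 \<K> l l'" for l l' \<xi>
    using hcomp_in[OF k that(1) k2 that(2)] .
  have obj: "id2 \<K> f \<star> \<epsilon> \<in> hom2 \<K> (f \<cdot> d) ((f \<cdot> l) \<cdot> k)"
    if "l \<in> hom1 \<K> K c" "\<epsilon> \<in> hom2 \<K> d (l \<cdot> k)" for l \<epsilon>
    using hcomp_in[OF d f that(2) f2] comp1_assoc[OF k that(1) f] by simp
  have mor: "((id2 \<K> f \<star> \<xi>) \<star> id2 \<K> k) \<bullet> (id2 \<K> f \<star> \<epsilon>) = id2 \<K> f \<star> ((\<xi> \<star> id2 \<K> k) \<bullet> \<epsilon>)"
    if "l \<in> hom1 \<K> K c" "\<epsilon> \<in> hom2 \<K> d (l \<cdot> k)" "\<xi> \<in> hom2 \<K> l l'" for l l' \<epsilon> \<xi>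
    using whisker_left_vcomp[OF d f that(2) w[OF that(1,3)]]
      hcomp_assoc[OF k that(1) f k2 that(3) f2] by simp
  show ?thesis
    unfolding is_functor_def
    using category_LE[OF k d] category_LE[OF k fd] f2 f
    by (auto simp: LE_def push_def cs mor id2_hcomp_id2
        intro: comp1_in obj hcomp_in whisker_left_vcomp)
qed

lemma is_functor_push_RE:
  assumes k: "k \<in> hom1 \<K> I K" and d: "d \<in> hom1 \<K> I c" and f: "f \<in> hom1 \<K> c c'"
  shows "is_functor (RE \<K> d k) (RE \<K> (f \<cdot> d) k) (push \<K> f)"
proof -
  have fd: "f \<cdot> d \<in> hom1 \<K> I c'" using d f by (rule comp1_in)
  have cs: "cod1 \<K> k = K" "cod1 \<K> d = c" "cod1 \<K> (f \<cdot> d) = c'"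
    using k d fd by (auto simp: hom1_def)
  have f2: "id2 \<K> f \<in> hom2 \<K> f f" and k2: "id2 \<K> k \<in> hom2 \<K> k k"
    using f k by (auto intro: id2_in hom1_Cell1)
  have w: "\<xi> \<star> id2 \<K> k \<in> hom2 \<K> (l \<cdot> k) (l' \<cdot> k)"
    if "l \<in> hom1 \<K> K c" "\<xi> \<in> hom2 \<K> l l'" for l l' \<xi>
    using hcomp_in[OF k that(1) k2 that(2)] .
  have obj: "id2 \<K> f \<star> \<epsilon> \<in> hom2 \<K> ((f \<cdot> l) \<cdot> k) (f \<cdot> d)"
    if "l \<in> hom1 \<K> K c" "\<epsilon> \<in> hom2 \<K> (l \<cdot> k) d" for l \<epsilon>
    using hcomp_in[OF comp1_in[OF k that(1)] f that(2) f2] comp1_assoc[OF k that(1) f] by simp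
  have mor: "(id2 \<K> f \<star> \<epsilon>) \<bullet> ((id2 \<K> f \<star> \<xi>) \<star> id2 \<K> k) = id2 \<K> f \<star> (\<epsilon> \<bullet> (\<xi> \<star> id2 \<K> k))"
    if "l \<in> hom1 \<K> K c" "\<epsilon> \<in> hom2 \<K> (l' \<cdot> k) d" "\<xi> \<in> hom2 \<K> l l'" for l l' \<epsilon> \<xi>
    using whisker_left_vcomp[OF comp1_in[OF k that(1)] f w[OF that(1,3)] that(2)]
      hcomp_assoc[OF k that(1) f k2 that(3) f2] by simp
  show ?thesis
    unfolding is_functor_def
    using category_RE[OF k d] category_RE[OF k fd] f2 f
    by (auto simp: RE_def push_def cs mor id2_hcomp_id2
        intro: comp1_in obj hcomp_in whisker_left_vcomp)
qed

end

end

theory Submission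
  imports Defs
begin

text \<open>A left Kan extension in \<open>Ins(f, g)\<close> is sought over a left Kan extension \<open>(l, \<epsilon>)\<close> of \<open>ud\<close>.
  As \<open>(fl, f\<epsilon>)\<close> is initial, there is exactly one 2-cell \<open>fl \<Rightarrow> gl\<close> compatible with
  \<open>\<phi>d : fud \<Rightarrow> gud\<close>, so \<open>l\<close> lifts uniquely to \<open>Ins(f, g)\<close>, and \<open>\<epsilon>\<close> lifts precisely by that
  compatibility. Comparison 2-cells out of \<open>l\<close> lift because the two sides of the required
  equation are morphisms out of the initial object \<open>(fl, f\<epsilon>)\<close>. For an equifier, only the
  equality of the parallel morphisms \<open>\<eta>l\<close> and \<open>\<theta>l\<close> out of \<open>(fl, f\<epsilon>)\<close> is needed, so quotient
  initiality suffices. For a product, \<open>LE(d, k)\<close> is the product of the categories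
  \<open>LE(\<pi>\<^sub>id, k)\<close>. Right Kan extensions are left Kan extensions after reversing all 2-cells.\<close>

section \<open>Initial objects in product categories\<close>

lemma initial_obj_obtain:
  assumes "initial_obj C x" "y \<in> Obj C"
  obtains m where "m \<in> Hom C x y" "\<And>n. n \<in> Hom C x y \<Longrightarrow> n = m"
  using assms by (auto simp: initial_obj_def elim!: ex1E dest!: bspec)

text \<open>An object \<open>y\<close> of one factor is tested by the family that has
  \<open>y\<close> at \<open>i\<close> and agrees with \<open>d\<close> elsewhere: the components of
  \<open>d\<close> themselves fill the other places.\<close>

lemma initial_obj_prod_catD:
  assumes "initial_obj (prod_cat J D) d" "i \<in> J"
  shows "initial_obj (D i) (d i)"
  unfolding initial_obj_def
proof (intro conjI ballI)
  have d: "d \<in> Obj (prod_cat J D)" using assms(1) by (simp add: initial_obj_def)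
  then show "d i \<in> Obj (D i)" using assms(2) by (auto simp: prod_cat_def)
  fix y assume "y \<in> Obj (D i)"
  with d assms(2) have "d(i := y) \<in> Obj (prod_cat J D)"
    by (auto simp: prod_cat_def PiE_iff extensional_def)
  then obtain m where m: "m \<in> Hom (prod_cat J D) d (d(i := y))"
    and uniq: "\<And>n. n \<in> Hom (prod_cat J D) d (d(i := y)) \<Longrightarrow> n = m"
    by (rule initial_obj_obtain[OF assms(1)]) (rule that)
  show "\<exists>!n. n \<in> Hom (D i) (d i) y"
  proof (rule ex1I)
    show "m i \<in> Hom (D i) (d i) y"
      using PiE_mem[OF m[unfolded prod_cat_def, simplified] assms(2)] by simp
    fix n assume "n \<in> Hom (D i) (d i) y"
    \<comment> \<open>Exchanging the component of \<open>m\<close> at \<open>i\<close> for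
      \<open>n\<close> gives another morphism of families, so uniqueness forces
      \<open>n = m i\<close>.\<close>
    with m assms(2) have "m(i := n) \<in> Hom (prod_cat J D) d (d(i := y))"
      by (auto simp: prod_cat_def PiE_iff extensional_def)
    from uniq[OF this] show "n = m i" by (metis fun_upd_same)
  qed
qed

text \<open>The functors \<open>H i\<close> make \<open>C\<close> isomorphic to
  \<open>prod_cat J D\<close>. This is put as unique existence on objects and on morphisms, the form
  in which the universal property of a product in a 2-category delivers it.\<close>

locale cat_product =
  fixes C :: "('o1, 'm1) cat" and J :: "'i set" and D :: "'i \<Rightarrow> ('o2, 'm2) cat"
    and H :: "'i \<Rightarrow> ('o1, 'm1, 'o2, 'm2) fctr"
  assumes is_functor: "i \<in> J \<Longrightarrow> is_functor C (D i) (H i)"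
    and ex1_obj: "(\<And>i. i \<in> J \<Longrightarrow> d i \<in> Obj (D i)) \<Longrightarrow>
      \<exists>!x. x \<in> Obj C \<and> (\<forall>i\<in>J. on_obj (H i) x = d i)"
    and ex1_mor: "\<lbrakk>x \<in> Obj C; y \<in> Obj C;
        \<And>i. i \<in> J \<Longrightarrow> m i \<in> Hom (D i) (on_obj (H i) x) (on_obj (H i) y)\<rbrakk> \<Longrightarrow>
      \<exists>!n. n \<in> Hom C x y \<and> (\<forall>i\<in>J. on_mor (H i) n = m i)"
begin

text \<open>From right to left, the unique morphisms in the factors assemble to one morphism by
  \<open>ex1_mor\<close>. From left to right, initiality is first carried over to
  \<open>prod_cat J D\<close>, where a single component can be varied, and then projected.\<close>

lemma initial_obj_iff:
  assumes x: "x \<in> Obj C"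
  shows "initial_obj C x \<longleftrightarrow> (\<forall>i\<in>J. initial_obj (D i) (on_obj (H i) x))"
proof
  have Hobj: "on_obj (H i) y \<in> Obj (D i)" if "i \<in> J" "y \<in> Obj C" for i y
    using is_functor that by (simp add: is_functor_def)
  have Hmor: "on_mor (H i) n \<in> Hom (D i) (on_obj (H i) y) (on_obj (H i) z)"
    if "i \<in> J" "y \<in> Obj C" "z \<in> Obj C" "n \<in> Hom C y z" for i y z n
    using is_functor that by (simp add: is_functor_def)
  let ?d = "\<lambda>i\<in>J. on_obj (H i) x"
  show "initial_obj C x" if "\<forall>i\<in>J. initial_obj (D i) (on_obj (H i) x)"
    unfolding initial_obj_def
  proof (intro conjI ballI x)
    fix y assume y: "y \<in> Obj C"
    have "\<forall>i\<in>J. \<exists>!m. m \<in> Hom (D i) (on_obj (H i) x) (on_obj (H i) y)"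
      using that Hobj y by (simp add: initial_obj_def)
    then obtain m where m: "\<And>i. i \<in> J \<Longrightarrow> m i \<in> Hom (D i) (on_obj (H i) x) (on_obj (H i) y)"
      and uniq: "\<And>i n. \<lbrakk>i \<in> J; n \<in> Hom (D i) (on_obj (H i) x) (on_obj (H i) y)\<rbrakk> \<Longrightarrow> n = m i"
      by metis
    show "\<exists>!n. n \<in> Hom C x y"
    proof -
      obtain n where "n \<in> Hom C x y" "\<forall>i\<in>J. on_mor (H i) n = m i"
        and n: "\<And>n'. \<lbrakk>n' \<in> Hom C x y; \<forall>i\<in>J. on_mor (H i) n' = m i\<rbrakk> \<Longrightarrow> n' = n"
        using ex1_mor[OF x y m] by auto
      moreover have "\<forall>i\<in>J. on_mor (H i) n' = m i" if "n' \<in> Hom C x y" for n'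
        using uniq Hmor[OF _ x y that] by blast
      ultimately show ?thesis by blast
    qed
  qed
  show "\<forall>i\<in>J. initial_obj (D i) (on_obj (H i) x)" if init: "initial_obj C x"
  proof -
    have "initial_obj (prod_cat J D) ?d"
      unfolding initial_obj_def
    proof (intro conjI ballI)
      show "?d \<in> Obj (prod_cat J D)" using Hobj x by (auto simp: prod_cat_def)
      fix z assume "z \<in> Obj (prod_cat J D)"
      then have "z i \<in> Obj (D i)" if "i \<in> J" for i
        using that by (auto simp: prod_cat_def)
      from ex1_obj[OF this] obtain y where y: "y \<in> Obj C"
        and yz: "\<And>i. i \<in> J \<Longrightarrow> on_obj (H i) y = z i" by metis
      obtain n where n: "n \<in> Hom C x y" and uniq: "\<And>n'. n' \<in> Hom C x y \<Longrightarrow> n' = n"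
        by (rule initial_obj_obtain[OF init y]) (rule that)
      have mem: "m \<in> Hom (prod_cat J D) ?d z \<longleftrightarrow> m \<in> extensional J \<and>
          (\<forall>i\<in>J. m i \<in> Hom (D i) (on_obj (H i) x) (on_obj (H i) y))" for m
        by (auto simp: prod_cat_def PiE_iff yz)
      show "\<exists>!m. m \<in> Hom (prod_cat J D) ?d z"
      proof (rule ex1I)
        show "(\<lambda>i\<in>J. on_mor (H i) n) \<in> Hom (prod_cat J D) ?d z"
          using Hmor[OF _ x y n] by (simp add: mem)
        fix m assume m: "m \<in> Hom (prod_cat J D) ?d z"
        \<comment> \<open>Every morphism of families comes from a morphism of \<open>C\<close>,
          which can only be \<open>n\<close>; so its components are the images of
          \<open>n\<close>.\<close>
        then obtain n' where "n' \<in> Hom C x y" "\<forall>i\<in>J. on_mor (H i) n' = m i"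
          using ex1_mor[OF x y, of m] mem by auto
        then show "m = (\<lambda>i\<in>J. on_mor (H i) n)"
          using m uniq by (intro extensionalityI[of _ J]) (auto simp: mem)
      qed
    qed
    from initial_obj_prod_catD[OF this] show ?thesis by auto
  qed
qed

lemma preserves_initial: "preserves_initial C J D H"
proof -
  have "x \<in> Obj C" if "initial_obj C x" for x using that by (simp add: initial_obj_def)
  then show ?thesis using initial_obj_iff unfolding preserves_initial_def by blast
qed

text \<open>An initial family is initial in each component, \<open>ex1_obj\<close> provides its only
  preimage, and \<open>initial_obj_iff\<close> reflects initiality.\<close>

lemma jointly_strictly_creates_initial: "jointly_strictly_creates_initial C J D H"
  unfolding jointly_strictly_creates_initial_def
proof (intro allI impI)
  fix d assume "initial_obj (prod_cat J D) d"
  then have d: "initial_obj (D i) (d i)" if "i \<in> J" for i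
    using initial_obj_prod_catD that by metis
  then have "\<exists>!x. x \<in> Obj C \<and> (\<forall>i\<in>J. on_obj (H i) x = d i)"
    by (intro ex1_obj) (simp add: initial_obj_def)
  then show "(\<exists>!x. x \<in> Obj C \<and> (\<forall>i\<in>J. on_obj (H i) x = d i)) \<and>
      (\<forall>x. x \<in> Obj C \<and> (\<forall>i\<in>J. on_obj (H i) x = d i) \<longrightarrow> initial_obj C x)"
    using d by (auto simp: initial_obj_iff)
qed

end

section \<open>Whiskering\<close>

context two_category
begin

lemma hom1_dom_in: "f \<in> hom1 \<K> x y \<Longrightarrow> x \<in> Cell0 \<K>"
  using dom1_in by (auto simp: hom1_def)

lemma hom1_cod_in: "f \<in> hom1 \<K> x y \<Longrightarrow> y \<in> Cell0 \<K>"
  using cod1_in by (auto simp: hom1_def)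

lemma hom2_cod_hom1: "\<lbrakk>f \<in> hom1 \<K> x y; \<alpha> \<in> hom2 \<K> f f'\<rbrakk> \<Longrightarrow> f' \<in> hom1 \<K> x y"
  using cod2_in dom1_cod2 cod1_cod2 by (auto simp: hom1_def hom2_def)

lemma hom2_dom_hom1: "\<lbrakk>f' \<in> hom1 \<K> x y; \<alpha> \<in> hom2 \<K> f f'\<rbrakk> \<Longrightarrow> f \<in> hom1 \<K> x y"
  using dom2_in dom1_cod2 cod1_cod2 by (auto simp: hom1_def hom2_def)

lemma id2_hom2: "f \<in> hom1 \<K> x y \<Longrightarrow> id2 \<K> f \<in> hom2 \<K> f f"
  by (simp add: hom1_Cell1 id2_in)

lemma whisker_left_in:
  assumes "l \<in> hom1 \<K> x y" "f \<in> hom1 \<K> y z" "\<alpha> \<in> hom2 \<K> l l'"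
  shows "id2 \<K> f \<star> \<alpha> \<in> hom2 \<K> (f \<cdot> l) (f \<cdot> l')"
  using assms hcomp_in id2_hom2 by blast

lemma whisker_right_in:
  assumes "k \<in> hom1 \<K> x y" "l \<in> hom1 \<K> y z" "\<alpha> \<in> hom2 \<K> l l'"
  shows "\<alpha> \<star> id2 \<K> k \<in> hom2 \<K> (l \<cdot> k) (l' \<cdot> k)"
  using assms hcomp_in id2_hom2 by blast

text \<open>Both sides are \<open>\<beta> \<star> \<alpha>\<close>: interchange merges each of them
  into a horizontal composite in which the identities cancel.\<close>

lemma whisker_exchange:
  assumes "f \<in> hom1 \<K> x y" "g \<in> hom1 \<K> y z" "\<alpha> \<in> hom2 \<K> f f'" "\<beta> \<in> hom2 \<K> g g'"
  shows "(\<beta> \<star> id2 \<K> f') \<bullet> (id2 \<K> g \<star> \<alpha>) = (id2 \<K> g' \<star> \<alpha>) \<bullet> (\<beta> \<star> id2 \<K> f)"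
proof -
  have f': "f' \<in> hom1 \<K> x y" and g': "g' \<in> hom1 \<K> y z"
    using assms hom2_cod_hom1 by blast+
  have "(\<beta> \<star> id2 \<K> f') \<bullet> (id2 \<K> g \<star> \<alpha>) = (\<beta> \<bullet> id2 \<K> g) \<star> (id2 \<K> f' \<bullet> \<alpha>)"
    using interchange[OF assms(1,2,3) id2_hom2[OF f'] id2_hom2[OF assms(2)] assms(4)] by simp
  also have "\<dots> = (id2 \<K> g' \<bullet> \<beta>) \<star> (\<alpha> \<bullet> id2 \<K> f)"
    using assms by (simp add: vcomp_id2 id2_vcomp)
  also have "\<dots> = (id2 \<K> g' \<star> \<alpha>) \<bullet> (\<beta> \<star> id2 \<K> f)"
    using interchange[OF assms(1,2) id2_hom2[OF assms(1)] assms(3,4) id2_hom2[OF g']] by simp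
  finally show ?thesis .
qed

lemma whisker_left_comp1:
  assumes "l \<in> hom1 \<K> w x" "f \<in> hom1 \<K> x y" "g \<in> hom1 \<K> y z" "\<alpha> \<in> hom2 \<K> l l'"
  shows "id2 \<K> g \<star> (id2 \<K> f \<star> \<alpha>) = id2 \<K> (g \<cdot> f) \<star> \<alpha>"
  using hcomp_assoc[OF assms(1-4) id2_hom2 id2_hom2] assms id2_hcomp_id2 by simp

lemma whisker_right_comp1:
  assumes "f \<in> hom1 \<K> w x" "g \<in> hom1 \<K> x y" "l \<in> hom1 \<K> y z" "\<alpha> \<in> hom2 \<K> l l'"
  shows "(\<alpha> \<star> id2 \<K> g) \<star> id2 \<K> f = \<alpha> \<star> id2 \<K> (g \<cdot> f)"
  using hcomp_assoc[OF assms(1-3) id2_hom2 id2_hom2 assms(4)] assms id2_hcomp_id2 by simp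

lemma whisker_assoc:
  assumes "k \<in> hom1 \<K> w x" "l \<in> hom1 \<K> x y" "f \<in> hom1 \<K> y z" "\<alpha> \<in> hom2 \<K> l l'"
  shows "id2 \<K> f \<star> (\<alpha> \<star> id2 \<K> k) = (id2 \<K> f \<star> \<alpha>) \<star> id2 \<K> k"
  using hcomp_assoc[OF assms(1-3) id2_hom2 assms(4) id2_hom2] assms by simp

section \<open>Left Kan extensions\<close>

lemma Obj_LE_iff:
  assumes "k \<in> hom1 \<K> I K" "d \<in> hom1 \<K> I c"
  shows "(l, \<epsilon>) \<in> Obj (LE \<K> d k) \<longleftrightarrow> l \<in> hom1 \<K> K c \<and> \<epsilon> \<in> hom2 \<K> d (l \<cdot> k)"
proof -
  have "cod1 \<K> k = K" "cod1 \<K> d = c" using assms by (auto simp: hom1_def)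
  then show ?thesis by (simp add: LE_def)
qed

lemma Hom_LE_iff:
  "\<xi> \<in> Hom (LE \<K> d k) (l, \<epsilon>) (l', \<epsilon>') \<longleftrightarrow>
    \<xi> \<in> hom2 \<K> l l' \<and> (\<xi> \<star> id2 \<K> k) \<bullet> \<epsilon> = \<epsilon>'"
  by (simp add: LE_def)

lemma on_obj_push: "on_obj (push \<K> f) (l, \<epsilon>) = (f \<cdot> l, id2 \<K> f \<star> \<epsilon>)"
  by (simp add: push_def)

lemma on_mor_push: "on_mor (push \<K> f) \<xi> = id2 \<K> f \<star> \<xi>"
  by (simp add: push_def)

section \<open>Strict creation along a 1-cell that is faithful on 2-cells\<close>

text \<open>The common part of the cases of inserters and equifiers. Since \<open>u\<close> is
  faithful on 2-cells, the lift of the unit is unique once the lift \<open>h\<close> of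
  \<open>l\<close> is fixed, and the triangle of a lifted comparison 2-cell can be checked after
  whiskering with \<open>u\<close>. Uniqueness in \<open>ex1_lift\<close> is asked among those
  \<open>h\<close> along which the unit lifts as well: over an inserter, one \<open>l\<close> can
  have several lifts, and the unit selects one of them.\<close>

lemma strictly_creates_left_kanI:
  assumes k: "k \<in> hom1 \<K> I K" and d: "d \<in> hom1 \<K> I e" and u: "u \<in> hom1 \<K> e c"
    and faithful: "\<And>x h h' \<alpha> \<beta>. \<lbrakk>h \<in> hom1 \<K> x e; \<alpha> \<in> hom2 \<K> h h'; \<beta> \<in> hom2 \<K> h h';
        id2 \<K> u \<star> \<alpha> = id2 \<K> u \<star> \<beta>\<rbrakk> \<Longrightarrow> \<alpha> = \<beta>"
    and ex1_lift: "\<And>l \<epsilon>. initial_obj (LE \<K> (u \<cdot> d) k) (l, \<epsilon>) \<Longrightarrow>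
        \<exists>!h. h \<in> hom1 \<K> K e \<and> u \<cdot> h = l \<and> (\<exists>\<delta>\<in>hom2 \<K> d (h \<cdot> k). id2 \<K> u \<star> \<delta> = \<epsilon>)"
    and ex_lift2: "\<And>h \<delta> h' \<delta>' \<xi>. \<lbrakk>(h, \<delta>) \<in> Obj (LE \<K> d k); (h', \<delta>') \<in> Obj (LE \<K> d k);
        initial_obj (LE \<K> (u \<cdot> d) k) (u \<cdot> h, id2 \<K> u \<star> \<delta>);
        \<xi> \<in> Hom (LE \<K> (u \<cdot> d) k) (u \<cdot> h, id2 \<K> u \<star> \<delta>) (u \<cdot> h', id2 \<K> u \<star> \<delta>')\<rbrakk> \<Longrightarrow>
        \<exists>\<zeta>\<in>hom2 \<K> h h'. id2 \<K> u \<star> \<zeta> = \<xi>"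
  shows "strictly_creates_left_kan \<K> u d k"
proof -
  let ?L = "LE \<K> d k" and ?L' = "LE \<K> (u \<cdot> d) k"
  note push = is_functor_push_LE[OF k d u]
  have ex1: "\<exists>!x. x \<in> Obj ?L \<and> on_obj (push \<K> u) x = y" if y: "initial_obj ?L' y" for y
  proof -
    obtain l \<epsilon> where y_eq: "y = (l, \<epsilon>)" by fastforce
    obtain h \<delta> where h: "h \<in> hom1 \<K> K e" "u \<cdot> h = l"
      and \<delta>: "\<delta> \<in> hom2 \<K> d (h \<cdot> k)" "id2 \<K> u \<star> \<delta> = \<epsilon>"
      and uniq: "\<And>h' \<delta>'. \<lbrakk>h' \<in> hom1 \<K> K e; u \<cdot> h' = l; \<delta>' \<in> hom2 \<K> d (h' \<cdot> k);
        id2 \<K> u \<star> \<delta>' = \<epsilon>\<rbrakk> \<Longrightarrow> h' = h"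
      using ex1_lift[of l \<epsilon>] y unfolding y_eq by metis
    show ?thesis
    proof (rule ex1I)
      show "(h, \<delta>) \<in> Obj ?L \<and> on_obj (push \<K> u) (h, \<delta>) = y"
        using h \<delta> by (simp add: Obj_LE_iff[OF k d] on_obj_push y_eq)
      fix x assume x: "x \<in> Obj ?L \<and> on_obj (push \<K> u) x = y"
      obtain h' \<delta>' where x_eq: "x = (h', \<delta>')" by fastforce
      have h': "h' \<in> hom1 \<K> K e" "u \<cdot> h' = l" "\<delta>' \<in> hom2 \<K> d (h' \<cdot> k)" "id2 \<K> u \<star> \<delta>' = \<epsilon>"
        using x by (simp_all add: Obj_LE_iff[OF k d] on_obj_push y_eq x_eq)
      have "h' = h" using uniq[OF h'] .
      moreover have "\<delta>' = \<delta>"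
        using faithful[OF d] h'(3,4) \<delta> \<open>h' = h\<close> by blast
      ultimately show "x = (h, \<delta>)" by (simp add: x_eq)
    qed
  qed
  have init: "initial_obj ?L x"
    if x: "x \<in> Obj ?L" and y: "initial_obj ?L' (on_obj (push \<K> u) x)" for x
    unfolding initial_obj_def
  proof (intro conjI ballI x)
    fix x' assume x': "x' \<in> Obj ?L"
    obtain h \<delta> h' \<delta>' where eqs: "x = (h, \<delta>)" "x' = (h', \<delta>')" by (metis surj_pair)
    have h: "h \<in> hom1 \<K> K e" "\<delta> \<in> hom2 \<K> d (h \<cdot> k)" and h': "h' \<in> hom1 \<K> K e" "\<delta>' \<in> hom2 \<K> d (h' \<cdot> k)"
      using x x' by (simp_all add: eqs Obj_LE_iff[OF k d])
    have "on_obj (push \<K> u) x' \<in> Obj ?L'" using push x' by (simp add: is_functor_def)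
    then obtain \<xi> where \<xi>: "\<xi> \<in> Hom ?L' (on_obj (push \<K> u) x) (on_obj (push \<K> u) x')"
      and uniq: "\<And>\<chi>. \<chi> \<in> Hom ?L' (on_obj (push \<K> u) x) (on_obj (push \<K> u) x') \<Longrightarrow> \<chi> = \<xi>"
      by (rule initial_obj_obtain[OF y]) (rule that)
    obtain \<zeta> where \<zeta>: "\<zeta> \<in> hom2 \<K> h h'" "id2 \<K> u \<star> \<zeta> = \<xi>"
      using ex_lift2 x x' y \<xi> unfolding eqs on_obj_push by blast
    show "\<exists>!\<chi>. \<chi> \<in> Hom ?L x x'"
    proof (rule ex1I)
      have hk: "\<zeta> \<star> id2 \<K> k \<in> hom2 \<K> (h \<cdot> k) (h' \<cdot> k)" using whisker_right_in[OF k h(1) \<zeta>(1)] .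
      \<comment> \<open>Whiskered with \<open>u\<close>, the triangle for \<zeta> becomes the one
        for \<xi>, which holds because \<xi> is a morphism of \<open>?L'\<close>.\<close>
      have "id2 \<K> u \<star> ((\<zeta> \<star> id2 \<K> k) \<bullet> \<delta>) = (\<xi> \<star> id2 \<K> k) \<bullet> (id2 \<K> u \<star> \<delta>)"
        using whisker_left_vcomp[OF d u h(2) hk] whisker_assoc[OF k h(1) u \<zeta>(1)] \<zeta>(2) by simp
      also have "\<dots> = id2 \<K> u \<star> \<delta>'"
        using \<xi> by (simp add: eqs on_obj_push Hom_LE_iff)
      finally have "(\<zeta> \<star> id2 \<K> k) \<bullet> \<delta> = \<delta>'"
        using faithful[OF d vcomp_in[OF h(2) hk] h'(2)] by blast
      then show "\<zeta> \<in> Hom ?L x x'" using \<zeta>(1) by (simp add: eqs Hom_LE_iff)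
      fix \<chi> assume \<chi>: "\<chi> \<in> Hom ?L x x'"
      \<comment> \<open>The image of \<chi> under \<open>u\<close> is a morphism out of an initial
        object, hence equals \<xi>; faithfulness then identifies \<chi> with \<zeta>.\<close>
      then have "id2 \<K> u \<star> \<chi> = \<xi>"
        using uniq[of "id2 \<K> u \<star> \<chi>"] push x x' by (simp add: is_functor_def on_mor_push)
      then show "\<chi> = \<zeta>"
        using faithful[OF h(1) _ \<zeta>(1)] \<chi> \<zeta>(2) by (simp add: eqs Hom_LE_iff)
    qed
  qed
  show ?thesis
    unfolding strictly_creates_left_kan_def jointly_strictly_creates_left_kan_def
      jointly_strictly_creates_initial_def
  proof (intro allI impI)
    fix y assume "initial_obj (prod_cat {()} (\<lambda>_. ?L')) y"
    from initial_obj_prod_catD[OF this] have "initial_obj ?L' (y ())" by simp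
    then show "(\<exists>!x. x \<in> Obj ?L \<and> (\<forall>i\<in>{()}. on_obj (push \<K> u) x = y i)) \<and>
        (\<forall>x. x \<in> Obj ?L \<and> (\<forall>i\<in>{()}. on_obj (push \<K> u) x = y i) \<longrightarrow> initial_obj ?L x)"
      using ex1 init by auto
  qed
qed

section \<open>Products\<close>

text \<open>For an object of \<open>LE \<K> d k\<close>, the universal property for 1-cells yields
  its 1-cell and the one for 2-cells its unit. For a morphism, the latter yields the 2-cell; its
  compatibility with the units holds because it holds after every projection.\<close>

lemma cat_product_LE:
  assumes prod: "is_product \<K> J cs c \<pi>"
    and k: "k \<in> hom1 \<K> I K" and d: "d \<in> hom1 \<K> I c"
  shows "cat_product (LE \<K> d k) J (\<lambda>i. LE \<K> (\<pi> i \<cdot> d) k) (\<lambda>i. push \<K> (\<pi> i))"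
proof
  have \<pi>: "\<pi> i \<in> hom1 \<K> c (cs i)" if "i \<in> J" for i
    using prod that by (simp add: is_product_def)
  have pr1: "\<exists>!h'. h' \<in> hom1 \<K> x c \<and> (\<forall>i\<in>J. \<pi> i \<cdot> h' = h i)"
    if "x \<in> Cell0 \<K>" "\<And>i. i \<in> J \<Longrightarrow> h i \<in> hom1 \<K> x (cs i)" for x h
    by (rule prod[unfolded is_product_def, THEN conjunct2, THEN conjunct2, THEN conjunct1,
        rule_format]) (fact that)+
  have pr2: "\<exists>!\<alpha>'. \<alpha>' \<in> hom2 \<K> h h' \<and> (\<forall>i\<in>J. id2 \<K> (\<pi> i) \<star> \<alpha>' = \<alpha> i)"
    if "h \<in> hom1 \<K> x c" "h' \<in> hom1 \<K> x c"
      "\<And>i. i \<in> J \<Longrightarrow> \<alpha> i \<in> hom2 \<K> (\<pi> i \<cdot> h) (\<pi> i \<cdot> h')" for x h h' \<alpha>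
    by (rule prod[unfolded is_product_def, THEN conjunct2, THEN conjunct2, THEN conjunct2,
        rule_format, OF hom1_dom_in[OF that(1)]]) (fact that)+
  have pd: "\<pi> i \<cdot> d \<in> hom1 \<K> I (cs i)" if "i \<in> J" for i
    using comp1_in[OF d \<pi>[OF that]] .
  show "is_functor (LE \<K> d k) (LE \<K> (\<pi> i \<cdot> d) k) (push \<K> (\<pi> i))" if "i \<in> J" for i
    using is_functor_push_LE[OF k d \<pi>[OF that]] .
  show "\<exists>!x. x \<in> Obj (LE \<K> d k) \<and> (\<forall>i\<in>J. on_obj (push \<K> (\<pi> i)) x = y i)"
    if "\<And>i. i \<in> J \<Longrightarrow> y i \<in> Obj (LE \<K> (\<pi> i \<cdot> d) k)" for y
  proof -
    have y: "fst (y i) \<in> hom1 \<K> K (cs i)" "snd (y i) \<in> hom2 \<K> (\<pi> i \<cdot> d) (fst (y i) \<cdot> k)"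
      if "i \<in> J" for i
      using \<open>\<And>i. i \<in> J \<Longrightarrow> y i \<in> Obj (LE \<K> (\<pi> i \<cdot> d) k)\<close>[OF that]
        Obj_LE_iff[OF k pd[OF that], of "fst (y i)" "snd (y i)"] by simp_all
    obtain h where h: "h \<in> hom1 \<K> K c" "\<And>i. i \<in> J \<Longrightarrow> \<pi> i \<cdot> h = fst (y i)"
      and h_uniq: "\<And>h'. \<lbrakk>h' \<in> hom1 \<K> K c; \<And>i. i \<in> J \<Longrightarrow> \<pi> i \<cdot> h' = fst (y i)\<rbrakk> \<Longrightarrow> h' = h"
      using pr1[OF hom1_cod_in[OF k], of "\<lambda>i. fst (y i)"] y(1) by metis
    have "snd (y i) \<in> hom2 \<K> (\<pi> i \<cdot> d) (\<pi> i \<cdot> (h \<cdot> k))" if "i \<in> J" for i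
      using y(2)[OF that] h(2)[OF that] comp1_assoc[OF k h(1) \<pi>[OF that]] by simp
    from pr2[OF d comp1_in[OF k h(1)] this]
    obtain \<epsilon> where \<epsilon>: "\<epsilon> \<in> hom2 \<K> d (h \<cdot> k)" "\<And>i. i \<in> J \<Longrightarrow> id2 \<K> (\<pi> i) \<star> \<epsilon> = snd (y i)"
      and \<epsilon>_uniq: "\<And>\<epsilon>'. \<lbrakk>\<epsilon>' \<in> hom2 \<K> d (h \<cdot> k);
        \<And>i. i \<in> J \<Longrightarrow> id2 \<K> (\<pi> i) \<star> \<epsilon>' = snd (y i)\<rbrakk> \<Longrightarrow> \<epsilon>' = \<epsilon>"
      by metis
    show ?thesis
    proof (rule ex1I)
      show "(h, \<epsilon>) \<in> Obj (LE \<K> d k) \<and> (\<forall>i\<in>J. on_obj (push \<K> (\<pi> i)) (h, \<epsilon>) = y i)"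
        using h \<epsilon> by (simp add: Obj_LE_iff[OF k d] on_obj_push)
      fix x assume x: "x \<in> Obj (LE \<K> d k) \<and> (\<forall>i\<in>J. on_obj (push \<K> (\<pi> i)) x = y i)"
      obtain h' \<epsilon>' where x_eq: "x = (h', \<epsilon>')" by fastforce
      have x': "h' \<in> hom1 \<K> K c" "\<epsilon>' \<in> hom2 \<K> d (h' \<cdot> k)"
        and eq: "\<And>i. i \<in> J \<Longrightarrow> \<pi> i \<cdot> h' = fst (y i) \<and> id2 \<K> (\<pi> i) \<star> \<epsilon>' = snd (y i)"
        using x by (auto simp: x_eq Obj_LE_iff[OF k d] on_obj_push dest!: bspec)
          (metis fst_conv snd_conv)+
      have "h' = h" using h_uniq x'(1) eq by blast
      moreover have "\<epsilon>' = \<epsilon>" using \<epsilon>_uniq x'(2) eq \<open>h' = h\<close> by blast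
      ultimately show "x = (h, \<epsilon>)" by (simp add: x_eq)
    qed
  qed
  show "\<exists>!n. n \<in> Hom (LE \<K> d k) x y \<and> (\<forall>i\<in>J. on_mor (push \<K> (\<pi> i)) n = m i)"
    if x: "x \<in> Obj (LE \<K> d k)" and y: "y \<in> Obj (LE \<K> d k)"
      and m: "\<And>i. i \<in> J \<Longrightarrow> m i \<in> Hom (LE \<K> (\<pi> i \<cdot> d) k)
        (on_obj (push \<K> (\<pi> i)) x) (on_obj (push \<K> (\<pi> i)) y)" for x y m
  proof -
    obtain l \<epsilon> l' \<epsilon>' where eqs: "x = (l, \<epsilon>)" "y = (l', \<epsilon>')" by (metis surj_pair)
    have l: "l \<in> hom1 \<K> K c" "\<epsilon> \<in> hom2 \<K> d (l \<cdot> k)"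
      and l': "l' \<in> hom1 \<K> K c" "\<epsilon>' \<in> hom2 \<K> d (l' \<cdot> k)"
      using x y by (simp_all add: eqs Obj_LE_iff[OF k d])
    have m': "m i \<in> hom2 \<K> (\<pi> i \<cdot> l) (\<pi> i \<cdot> l')"
      "(m i \<star> id2 \<K> k) \<bullet> (id2 \<K> (\<pi> i) \<star> \<epsilon>) = id2 \<K> (\<pi> i) \<star> \<epsilon>'" if "i \<in> J" for i
      using m[OF that] by (simp_all add: eqs on_obj_push Hom_LE_iff)
    from pr2[OF l(1) l'(1) m'(1)] obtain n where n: "n \<in> hom2 \<K> l l'"
      "\<And>i. i \<in> J \<Longrightarrow> id2 \<K> (\<pi> i) \<star> n = m i"
      and uniq: "\<And>n'. \<lbrakk>n' \<in> hom2 \<K> l l'; \<And>i. i \<in> J \<Longrightarrow> id2 \<K> (\<pi> i) \<star> n' = m i\<rbrakk> \<Longrightarrow> n' = n"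
      by metis
    have nk: "n \<star> id2 \<K> k \<in> hom2 \<K> (l \<cdot> k) (l' \<cdot> k)" using whisker_right_in[OF k l(1) n(1)] .
    have "id2 \<K> (\<pi> i) \<star> ((n \<star> id2 \<K> k) \<bullet> \<epsilon>) = id2 \<K> (\<pi> i) \<star> \<epsilon>'" if i: "i \<in> J" for i
      using whisker_left_vcomp[OF d \<pi>[OF i] l(2) nk] whisker_assoc[OF k l(1) \<pi>[OF i] n(1)]
        n(2)[OF i] m'(2)[OF i] by simp
    moreover have "id2 \<K> (\<pi> i) \<star> \<epsilon>' \<in> hom2 \<K> (\<pi> i \<cdot> d) (\<pi> i \<cdot> (l' \<cdot> k))" if "i \<in> J" for i
      using whisker_left_in[OF d \<pi>[OF that] l'(2)] .
    \<comment> \<open>Two 2-cells into \<open>c\<close> with the same projections agree, by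
      uniqueness in \<open>pr2\<close> for the family of projections of
      \<open>\<epsilon>'\<close>.\<close>
    ultimately have "(n \<star> id2 \<K> k) \<bullet> \<epsilon> = \<epsilon>'"
      using pr2[OF d comp1_in[OF k l'(1)], of "\<lambda>i. id2 \<K> (\<pi> i) \<star> \<epsilon>'"]
        vcomp_in[OF l(2) nk] l'(2) by metis
    show ?thesis
    proof (rule ex1I)
      show "n \<in> Hom (LE \<K> d k) x y \<and> (\<forall>i\<in>J. on_mor (push \<K> (\<pi> i)) n = m i)"
        using n \<open>(n \<star> id2 \<K> k) \<bullet> \<epsilon> = \<epsilon>'\<close> by (simp add: eqs Hom_LE_iff on_mor_push)
      fix n' assume "n' \<in> Hom (LE \<K> d k) x y \<and> (\<forall>i\<in>J. on_mor (push \<K> (\<pi> i)) n' = m i)"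
      then show "n' = n" by (intro uniq) (simp_all add: eqs Hom_LE_iff on_mor_push)
    qed
  qed
qed

lemma product_left_kan:
  assumes "is_product \<K> J cs c \<pi>" "k \<in> hom1 \<K> I K" "d \<in> hom1 \<K> I c"
  shows "family_preserves_left_kan \<K> J \<pi> d k" "jointly_strictly_creates_left_kan \<K> J \<pi> d k"
proof -
  interpret cat_product "LE \<K> d k" J "\<lambda>i. LE \<K> (\<pi> i \<cdot> d) k" "\<lambda>i. push \<K> (\<pi> i)"
    using cat_product_LE[OF assms] .
  show "family_preserves_left_kan \<K> J \<pi> d k"
    unfolding family_preserves_left_kan_def by (rule preserves_initial)
  show "jointly_strictly_creates_left_kan \<K> J \<pi> d k"
    unfolding jointly_strictly_creates_left_kan_def by (rule jointly_strictly_creates_initial)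
qed

section \<open>Inserters\<close>

text \<open>Initiality of the image under \<open>f\<close> is used with two targets: with 1-cell
  \<open>g \<cdot> l\<close>, to find and single out the structure on \<open>l\<close>, and with
  1-cell \<open>g \<cdot> (u \<cdot> h')\<close>, to show that \<xi> respects the
  structures.\<close>

lemma inserter_left_kan:
  assumes ins: "is_inserter \<K> a b f g e u \<phi>"
    and k: "k \<in> hom1 \<K> I K" and d: "d \<in> hom1 \<K> I e"
    and pres: "preserves_left_kan \<K> f (u \<cdot> d) k"
  shows "strictly_creates_left_kan \<K> u d k"
proof -
  have f: "f \<in> hom1 \<K> a b" and g: "g \<in> hom1 \<K> a b" and u: "u \<in> hom1 \<K> e a"
    and \<phi>: "\<phi> \<in> hom2 \<K> (f \<cdot> u) (g \<cdot> u)"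
    using ins by (simp_all add: is_inserter_def)
  have ins1: "\<exists>!h. h \<in> hom1 \<K> x e \<and> l = u \<cdot> h \<and> \<alpha> = \<phi> \<star> id2 \<K> h"
    if "l \<in> hom1 \<K> x a" "\<alpha> \<in> hom2 \<K> (f \<cdot> l) (g \<cdot> l)" for x l \<alpha>
    by (rule ins[unfolded is_inserter_def, THEN conjunct2, THEN conjunct2, THEN conjunct2,
        THEN conjunct2, THEN conjunct2, THEN conjunct1, rule_format, OF hom1_dom_in[OF that(1)] that])
  have ins2: "\<exists>!\<alpha>. \<alpha> \<in> hom2 \<K> h h' \<and> \<alpha>' = id2 \<K> u \<star> \<alpha>"
    if "h \<in> hom1 \<K> x e" "h' \<in> hom1 \<K> x e" "\<alpha>' \<in> hom2 \<K> (u \<cdot> h) (u \<cdot> h')"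
      "(id2 \<K> g \<star> \<alpha>') \<bullet> (\<phi> \<star> id2 \<K> h) = (\<phi> \<star> id2 \<K> h') \<bullet> (id2 \<K> f \<star> \<alpha>')" for x h h' \<alpha>'
    by (rule ins[unfolded is_inserter_def, THEN conjunct2, THEN conjunct2, THEN conjunct2,
        THEN conjunct2, THEN conjunct2, THEN conjunct2, rule_format, OF hom1_dom_in[OF that(1)] that])
  have ud: "u \<cdot> d \<in> hom1 \<K> I a" and fu: "f \<cdot> u \<in> hom1 \<K> e b" and gu: "g \<cdot> u \<in> hom1 \<K> e b"
    using comp1_in d u f g by blast+
  have fud: "f \<cdot> (u \<cdot> d) \<in> hom1 \<K> I b" using comp1_in ud f by blast
  \<comment> \<open>A 2-cell that comes from the inserter satisfies the condition of its
    2-dimensional universal property, by the exchange law for \<phi> and \<zeta>.\<close>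
  have natural: "(\<phi> \<star> id2 \<K> h') \<bullet> (id2 \<K> f \<star> (id2 \<K> u \<star> \<zeta>)) =
      (id2 \<K> g \<star> (id2 \<K> u \<star> \<zeta>)) \<bullet> (\<phi> \<star> id2 \<K> h)"
    if "h \<in> hom1 \<K> x e" "\<zeta> \<in> hom2 \<K> h h'" for x h h' \<zeta>
    using whisker_exchange[OF that(1) fu that(2) \<phi>] whisker_left_comp1[OF that(1) u f that(2)]
      whisker_left_comp1[OF that(1) u g that(2)] by simp
  have \<phi>_in: "\<phi> \<star> id2 \<K> h \<in> hom2 \<K> (f \<cdot> (u \<cdot> h)) (g \<cdot> (u \<cdot> h))" if "h \<in> hom1 \<K> x e" for x h
    using whisker_right_in[OF that fu \<phi>] comp1_assoc[OF that u f] comp1_assoc[OF that u g] by simp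
  \<comment> \<open>By \<open>natural\<close>, whiskered 2-cells fall under \<open>ins2\<close>,
    whose uniqueness clause is faithfulness.\<close>
  have faithful: "\<alpha> = \<beta>"
    if "h \<in> hom1 \<K> x e" "\<alpha> \<in> hom2 \<K> h h'" "\<beta> \<in> hom2 \<K> h h'"
      "id2 \<K> u \<star> \<alpha> = id2 \<K> u \<star> \<beta>" for x h h' \<alpha> \<beta>
    using ins2[OF that(1) hom2_cod_hom1[OF that(1,2)] whisker_left_in[OF that(1) u that(2)]
        natural[OF that(1,2), symmetric]] that(2-4) by metis
  have f_initial: "initial_obj (LE \<K> (f \<cdot> (u \<cdot> d)) k) (f \<cdot> l, id2 \<K> f \<star> \<epsilon>)"
    if "initial_obj (LE \<K> (u \<cdot> d) k) (l, \<epsilon>)" for l \<epsilon>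
    using pres that unfolding preserves_left_kan_def family_preserves_left_kan_def
      preserves_initial_def by (auto simp: on_obj_push)
  show ?thesis
  proof (rule strictly_creates_left_kanI[OF k d u faithful])
    fix l \<epsilon> assume init: "initial_obj (LE \<K> (u \<cdot> d) k) (l, \<epsilon>)"
    then have l: "l \<in> hom1 \<K> K a" and \<epsilon>: "\<epsilon> \<in> hom2 \<K> (u \<cdot> d) (l \<cdot> k)"
      using Obj_LE_iff[OF k ud] by (simp_all add: initial_obj_def)
    have lk: "l \<cdot> k \<in> hom1 \<K> I a" and gl: "g \<cdot> l \<in> hom1 \<K> K b" using comp1_in k l g by blast+
    have g\<epsilon>: "id2 \<K> g \<star> \<epsilon> \<in> hom2 \<K> (g \<cdot> (u \<cdot> d)) ((g \<cdot> l) \<cdot> k)"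
      using whisker_left_in[OF ud g \<epsilon>] comp1_assoc[OF k l g] by simp
    \<comment> \<open>The unit of this object is chosen so that a morphism to it from
      \<open>(f \<cdot> l, id2 \<K> f \<star> \<epsilon>)\<close> is a structure on \<open>l\<close>
      which \<epsilon> respects, in the sense of the inserter condition.\<close>
    have "(g \<cdot> l, (id2 \<K> g \<star> \<epsilon>) \<bullet> (\<phi> \<star> id2 \<K> d)) \<in> Obj (LE \<K> (f \<cdot> (u \<cdot> d)) k)"
      using gl vcomp_in[OF \<phi>_in[OF d] g\<epsilon>] by (simp add: Obj_LE_iff[OF k fud])
    then obtain \<alpha>
      where \<alpha>_mor: "\<alpha> \<in> Hom (LE \<K> (f \<cdot> (u \<cdot> d)) k) (f \<cdot> l, id2 \<K> f \<star> \<epsilon>)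
          (g \<cdot> l, (id2 \<K> g \<star> \<epsilon>) \<bullet> (\<phi> \<star> id2 \<K> d))"
      and uniq: "\<And>\<beta>. \<beta> \<in> Hom (LE \<K> (f \<cdot> (u \<cdot> d)) k) (f \<cdot> l, id2 \<K> f \<star> \<epsilon>)
          (g \<cdot> l, (id2 \<K> g \<star> \<epsilon>) \<bullet> (\<phi> \<star> id2 \<K> d)) \<Longrightarrow> \<beta> = \<alpha>"
      by (rule initial_obj_obtain[OF f_initial[OF init]]) (rule that)
    from \<alpha>_mor have \<alpha>: "\<alpha> \<in> hom2 \<K> (f \<cdot> l) (g \<cdot> l)"
      "(\<alpha> \<star> id2 \<K> k) \<bullet> (id2 \<K> f \<star> \<epsilon>) = (id2 \<K> g \<star> \<epsilon>) \<bullet> (\<phi> \<star> id2 \<K> d)"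
      by (simp_all add: Hom_LE_iff)
    obtain h where h: "h \<in> hom1 \<K> K e" "l = u \<cdot> h" "\<alpha> = \<phi> \<star> id2 \<K> h"
      and h_uniq: "\<And>h'. \<lbrakk>h' \<in> hom1 \<K> K e; l = u \<cdot> h'; \<alpha> = \<phi> \<star> id2 \<K> h'\<rbrakk> \<Longrightarrow> h' = h"
      using ins1[OF l \<alpha>(1)] by metis
    show "\<exists>!h. h \<in> hom1 \<K> K e \<and> u \<cdot> h = l \<and> (\<exists>\<delta>\<in>hom2 \<K> d (h \<cdot> k). id2 \<K> u \<star> \<delta> = \<epsilon>)"
    proof (rule ex1I)
      have hk: "h \<cdot> k \<in> hom1 \<K> I e" using comp1_in k h(1) by blast
      have "\<epsilon> \<in> hom2 \<K> (u \<cdot> d) (u \<cdot> (h \<cdot> k))"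
        using \<epsilon> h(2) comp1_assoc[OF k h(1) u] by simp
      \<comment> \<open>As \<alpha> is \<open>\<phi> \<star> id2 \<K> h\<close>, its triangle is
        exactly the condition of \<open>ins2\<close> for lifting \<epsilon> to a 2-cell from
        \<open>d\<close> to \<open>h \<cdot> k\<close>.\<close>
      moreover have "(id2 \<K> g \<star> \<epsilon>) \<bullet> (\<phi> \<star> id2 \<K> d) = (\<phi> \<star> id2 \<K> (h \<cdot> k)) \<bullet> (id2 \<K> f \<star> \<epsilon>)"
        using \<alpha>(2) h(3) whisker_right_comp1[OF k h(1) fu \<phi>] by simp
      ultimately have "\<exists>\<delta>\<in>hom2 \<K> d (h \<cdot> k). id2 \<K> u \<star> \<delta> = \<epsilon>"
        using ins2[OF d hk] by metis
      then show "h \<in> hom1 \<K> K e \<and> u \<cdot> h = l \<and> (\<exists>\<delta>\<in>hom2 \<K> d (h \<cdot> k). id2 \<K> u \<star> \<delta> = \<epsilon>)"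
        using h by simp
      fix h' assume "h' \<in> hom1 \<K> K e \<and> u \<cdot> h' = l \<and> (\<exists>\<delta>\<in>hom2 \<K> d (h' \<cdot> k). id2 \<K> u \<star> \<delta> = \<epsilon>)"
      then obtain \<delta> where h': "h' \<in> hom1 \<K> K e" "u \<cdot> h' = l"
        and \<delta>: "\<delta> \<in> hom2 \<K> d (h' \<cdot> k)" "id2 \<K> u \<star> \<delta> = \<epsilon>" by blast
      \<comment> \<open>If \<epsilon> lifts along \<open>h'\<close>, naturality at its lift makes
        \<open>\<phi> \<star> id2 \<K> h'\<close> a morphism to the same object as \<alpha>, so the
        two agree.\<close>
      have "\<phi> \<star> id2 \<K> h' = \<alpha>"
      proof (rule uniq, unfold Hom_LE_iff, rule conjI)
        show "\<phi> \<star> id2 \<K> h' \<in> hom2 \<K> (f \<cdot> l) (g \<cdot> l)" using \<phi>_in h' by auto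
        show "((\<phi> \<star> id2 \<K> h') \<star> id2 \<K> k) \<bullet> (id2 \<K> f \<star> \<epsilon>) = (id2 \<K> g \<star> \<epsilon>) \<bullet> (\<phi> \<star> id2 \<K> d)"
          using natural[OF d \<delta>(1)] \<delta>(2) whisker_right_comp1[OF k h'(1) fu \<phi>] by simp
      qed
      then show "h' = h" using h_uniq h' by blast
    qed
  next
    fix h \<delta> h' \<delta>' \<xi>
    assume "(h, \<delta>) \<in> Obj (LE \<K> d k)" "(h', \<delta>') \<in> Obj (LE \<K> d k)"
      and init: "initial_obj (LE \<K> (u \<cdot> d) k) (u \<cdot> h, id2 \<K> u \<star> \<delta>)"
      and "\<xi> \<in> Hom (LE \<K> (u \<cdot> d) k) (u \<cdot> h, id2 \<K> u \<star> \<delta>) (u \<cdot> h', id2 \<K> u \<star> \<delta>')"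
    then have h: "h \<in> hom1 \<K> K e" "\<delta> \<in> hom2 \<K> d (h \<cdot> k)"
      and h': "h' \<in> hom1 \<K> K e" "\<delta>' \<in> hom2 \<K> d (h' \<cdot> k)"
      and \<xi>: "\<xi> \<in> hom2 \<K> (u \<cdot> h) (u \<cdot> h')" "(\<xi> \<star> id2 \<K> k) \<bullet> (id2 \<K> u \<star> \<delta>) = id2 \<K> u \<star> \<delta>'"
      by (simp_all add: Obj_LE_iff[OF k d] Hom_LE_iff)
    let ?\<epsilon> = "id2 \<K> u \<star> \<delta>" and ?\<epsilon>' = "id2 \<K> u \<star> \<delta>'"
    \<comment> \<open>\<open>?\<alpha>\<close> and \<open>?\<beta>\<close> are the two sides of the
      condition under which \<xi> lifts; \<open>?\<gamma>\<close> is the unit that makes both of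
      them morphisms out of the image under \<open>f\<close> of the initial object.\<close>
    let ?\<alpha> = "(id2 \<K> g \<star> \<xi>) \<bullet> (\<phi> \<star> id2 \<K> h)" and ?\<beta> = "(\<phi> \<star> id2 \<K> h') \<bullet> (id2 \<K> f \<star> \<xi>)"
    let ?\<gamma> = "(id2 \<K> g \<star> ?\<epsilon>') \<bullet> (\<phi> \<star> id2 \<K> d)"
    have uh: "u \<cdot> h \<in> hom1 \<K> K a" and uh': "u \<cdot> h' \<in> hom1 \<K> K a" using comp1_in h h' u by blast+
    have fuh: "f \<cdot> (u \<cdot> h) \<in> hom1 \<K> K b" and fuh': "f \<cdot> (u \<cdot> h') \<in> hom1 \<K> K b"
      and guh: "g \<cdot> (u \<cdot> h) \<in> hom1 \<K> K b" and guh': "g \<cdot> (u \<cdot> h') \<in> hom1 \<K> K b"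
      using comp1_in uh uh' f g by blast+
    have \<epsilon>: "?\<epsilon> \<in> hom2 \<K> (u \<cdot> d) ((u \<cdot> h) \<cdot> k)" and \<epsilon>': "?\<epsilon>' \<in> hom2 \<K> (u \<cdot> d) ((u \<cdot> h') \<cdot> k)"
      using whisker_left_in[OF d u h(2)] whisker_left_in[OF d u h'(2)]
        comp1_assoc[OF k h(1) u] comp1_assoc[OF k h'(1) u] by simp_all
    have f\<epsilon>: "id2 \<K> f \<star> ?\<epsilon> \<in> hom2 \<K> (f \<cdot> (u \<cdot> d)) ((f \<cdot> (u \<cdot> h)) \<cdot> k)"
      and g\<epsilon>: "id2 \<K> g \<star> ?\<epsilon> \<in> hom2 \<K> (g \<cdot> (u \<cdot> d)) ((g \<cdot> (u \<cdot> h)) \<cdot> k)"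
      and g\<epsilon>': "id2 \<K> g \<star> ?\<epsilon>' \<in> hom2 \<K> (g \<cdot> (u \<cdot> d)) ((g \<cdot> (u \<cdot> h')) \<cdot> k)"
      using whisker_left_in[OF ud f \<epsilon>] whisker_left_in[OF ud g \<epsilon>] whisker_left_in[OF ud g \<epsilon>']
        comp1_assoc[OF k uh f] comp1_assoc[OF k uh g] comp1_assoc[OF k uh' g] by simp_all
    have f\<xi>: "id2 \<K> f \<star> \<xi> \<in> hom2 \<K> (f \<cdot> (u \<cdot> h)) (f \<cdot> (u \<cdot> h'))"
      and g\<xi>: "id2 \<K> g \<star> \<xi> \<in> hom2 \<K> (g \<cdot> (u \<cdot> h)) (g \<cdot> (u \<cdot> h'))"
      using whisker_left_in[OF uh _ \<xi>(1)] f g by blast+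
    have \<xi>k: "\<xi> \<star> id2 \<K> k \<in> hom2 \<K> ((u \<cdot> h) \<cdot> k) ((u \<cdot> h') \<cdot> k)"
      using whisker_right_in[OF k uh \<xi>(1)] .
    note \<phi>h = \<phi>_in[OF h(1)] and \<phi>h' = \<phi>_in[OF h'(1)] and \<phi>d = \<phi>_in[OF d]
    have \<alpha>: "?\<alpha> \<in> hom2 \<K> (f \<cdot> (u \<cdot> h)) (g \<cdot> (u \<cdot> h'))" using vcomp_in[OF \<phi>h g\<xi>] .
    have \<beta>: "?\<beta> \<in> hom2 \<K> (f \<cdot> (u \<cdot> h)) (g \<cdot> (u \<cdot> h'))" using vcomp_in[OF f\<xi> \<phi>h'] .
    have \<gamma>: "(g \<cdot> (u \<cdot> h'), ?\<gamma>) \<in> Obj (LE \<K> (f \<cdot> (u \<cdot> d)) k)"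
      using guh' vcomp_in[OF \<phi>d g\<epsilon>'] by (simp add: Obj_LE_iff[OF k fud])
    have f\<xi>_eq: "((id2 \<K> f \<star> \<xi>) \<star> id2 \<K> k) \<bullet> (id2 \<K> f \<star> ?\<epsilon>) = id2 \<K> f \<star> ?\<epsilon>'"
      using whisker_left_vcomp[OF ud f \<epsilon> \<xi>k] whisker_assoc[OF k uh f \<xi>(1)] \<xi>(2) by simp
    have g\<xi>_eq: "((id2 \<K> g \<star> \<xi>) \<star> id2 \<K> k) \<bullet> (id2 \<K> g \<star> ?\<epsilon>) = id2 \<K> g \<star> ?\<epsilon>'"
      using whisker_left_vcomp[OF ud g \<epsilon> \<xi>k] whisker_assoc[OF k uh g \<xi>(1)] \<xi>(2) by simp
    \<comment> \<open>\<open>natural\<close> at \<delta> trades \<phi> at \<open>h\<close> for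
      \<phi> at \<open>d\<close>; then the triangle for \<xi>, whiskered with \<open>g\<close>,
      applies.\<close>
    have "(?\<alpha> \<star> id2 \<K> k) \<bullet> (id2 \<K> f \<star> ?\<epsilon>) =
        ((id2 \<K> g \<star> \<xi>) \<star> id2 \<K> k) \<bullet> (((\<phi> \<star> id2 \<K> h) \<star> id2 \<K> k) \<bullet> (id2 \<K> f \<star> ?\<epsilon>))"
      using whisker_right_vcomp[OF k fuh \<phi>h g\<xi>] vcomp_assoc[OF f\<epsilon> whisker_right_in[OF k fuh \<phi>h]
        whisker_right_in[OF k guh g\<xi>]] by simp
    also have "\<dots> = ((id2 \<K> g \<star> \<xi>) \<star> id2 \<K> k) \<bullet> ((id2 \<K> g \<star> ?\<epsilon>) \<bullet> (\<phi> \<star> id2 \<K> d))"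
      using natural[OF d h(2)] whisker_right_comp1[OF k h(1) fu \<phi>] by simp
    also have "\<dots> = ?\<gamma>"
      using vcomp_assoc[OF \<phi>d g\<epsilon> whisker_right_in[OF k guh g\<xi>]] g\<xi>_eq by simp
    finally have \<alpha>_mor: "?\<alpha> \<in> Hom (LE \<K> (f \<cdot> (u \<cdot> d)) k)
        (f \<cdot> (u \<cdot> h), id2 \<K> f \<star> ?\<epsilon>) (g \<cdot> (u \<cdot> h'), ?\<gamma>)"
      using \<alpha> by (simp add: Hom_LE_iff)
    \<comment> \<open>Here the triangle for \<xi>, whiskered with \<open>f\<close>, comes first, and
      \<open>natural\<close> at \<open>\<delta>'\<close> second.\<close>
    have "(?\<beta> \<star> id2 \<K> k) \<bullet> (id2 \<K> f \<star> ?\<epsilon>) =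
        ((\<phi> \<star> id2 \<K> h') \<star> id2 \<K> k) \<bullet> (((id2 \<K> f \<star> \<xi>) \<star> id2 \<K> k) \<bullet> (id2 \<K> f \<star> ?\<epsilon>))"
      using whisker_right_vcomp[OF k fuh f\<xi> \<phi>h'] vcomp_assoc[OF f\<epsilon> whisker_right_in[OF k fuh f\<xi>]
        whisker_right_in[OF k fuh' \<phi>h']] by simp
    also have "\<dots> = ?\<gamma>"
      using f\<xi>_eq natural[OF d h'(2)] whisker_right_comp1[OF k h'(1) fu \<phi>] by simp
    finally have \<beta>_mor: "?\<beta> \<in> Hom (LE \<K> (f \<cdot> (u \<cdot> d)) k)
        (f \<cdot> (u \<cdot> h), id2 \<K> f \<star> ?\<epsilon>) (g \<cdot> (u \<cdot> h'), ?\<gamma>)"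
      using \<beta> by (simp add: Hom_LE_iff)
    have "?\<alpha> = ?\<beta>"
      using f_initial[OF init] \<gamma> \<alpha>_mor \<beta>_mor unfolding initial_obj_def by blast
    from ins2[OF h(1) h'(1) \<xi>(1) this] show "\<exists>\<zeta>\<in>hom2 \<K> h h'. id2 \<K> u \<star> \<zeta> = \<xi>" by metis
  qed
qed

section \<open>Equifiers\<close>

text \<open>Full faithfulness of whiskering with \<open>u\<close> lifts the unit and the comparison
  2-cells; the assumption on \<open>f\<close> serves to lift the 1-cell \<open>l\<close>.\<close>

lemma equifier_left_kan:
  assumes equ: "is_equifier \<K> c c' f g \<eta> \<theta> e u"
    and k: "k \<in> hom1 \<K> I K" and d: "d \<in> hom1 \<K> I e"
    and pres: "preserves_quotient_initiality_of_left_kan \<K> f (u \<cdot> d) k"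
  shows "strictly_creates_left_kan \<K> u d k"
proof -
  have f: "f \<in> hom1 \<K> c c'" and g: "g \<in> hom1 \<K> c c'" and u: "u \<in> hom1 \<K> e c"
    and \<eta>: "\<eta> \<in> hom2 \<K> f g" and \<theta>: "\<theta> \<in> hom2 \<K> f g" and \<eta>\<theta>: "\<eta> \<star> id2 \<K> u = \<theta> \<star> id2 \<K> u"
    using equ by (simp_all add: is_equifier_def)
  have equ1: "\<exists>!h. h \<in> hom1 \<K> x e \<and> l = u \<cdot> h"
    if "l \<in> hom1 \<K> x c" "\<eta> \<star> id2 \<K> l = \<theta> \<star> id2 \<K> l" for x l
    by (rule equ[unfolded is_equifier_def, THEN conjunct2, THEN conjunct2, THEN conjunct2,
        THEN conjunct2, THEN conjunct2, THEN conjunct2, THEN conjunct2, THEN conjunct1,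
        rule_format, OF hom1_dom_in[OF that(1)] that])
  have bij: "bij_betw (\<lambda>\<alpha>. id2 \<K> u \<star> \<alpha>) (hom2 \<K> h h') (hom2 \<K> (u \<cdot> h) (u \<cdot> h'))"
    if "h \<in> hom1 \<K> x e" "h' \<in> hom1 \<K> x e" for x h h'
    using equ that hom1_dom_in[OF that(1)]
    by (auto simp: is_equifier_def fully_faithful_def hom_cat_def postcomp_def)
  have full: "\<exists>\<zeta>\<in>hom2 \<K> h h'. id2 \<K> u \<star> \<zeta> = \<xi>"
    if "h \<in> hom1 \<K> x e" "h' \<in> hom1 \<K> x e" "\<xi> \<in> hom2 \<K> (u \<cdot> h) (u \<cdot> h')" for x h h' \<xi>
    using that(3)[folded bij_betw_imp_surj_on[OF bij[OF that(1,2)]]] by auto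
  have faithful: "\<alpha> = \<beta>"
    if "h \<in> hom1 \<K> x e" "\<alpha> \<in> hom2 \<K> h h'" "\<beta> \<in> hom2 \<K> h h'"
      "id2 \<K> u \<star> \<alpha> = id2 \<K> u \<star> \<beta>" for x h h' \<alpha> \<beta>
    using bij_betw_imp_inj_on[OF bij[OF that(1) hom2_cod_hom1[OF that(1,2)]]] that(2-4)
    by (simp add: inj_on_def)
  have ud: "u \<cdot> d \<in> hom1 \<K> I c" using comp1_in d u by blast
  have fud: "f \<cdot> (u \<cdot> d) \<in> hom1 \<K> I c'" using comp1_in ud f by blast
  show ?thesis
  proof (rule strictly_creates_left_kanI[OF k d u faithful])
    fix l \<epsilon> assume init: "initial_obj (LE \<K> (u \<cdot> d) k) (l, \<epsilon>)"
    then have l: "l \<in> hom1 \<K> K c" and \<epsilon>: "\<epsilon> \<in> hom2 \<K> (u \<cdot> d) (l \<cdot> k)"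
      using Obj_LE_iff[OF k ud] by (simp_all add: initial_obj_def)
    let ?\<gamma> = "(id2 \<K> g \<star> \<epsilon>) \<bullet> (\<eta> \<star> id2 \<K> (u \<cdot> d))"
    \<comment> \<open>Equality over \<open>u\<close> restricts along \<open>d\<close>, so \<eta> and
      \<theta> define the same unit on \<open>g \<cdot> l\<close>, and their whiskerings with
      \<open>l\<close> get the same target.\<close>
    have \<eta>\<theta>d: "\<theta> \<star> id2 \<K> (u \<cdot> d) = \<eta> \<star> id2 \<K> (u \<cdot> d)"
      using whisker_right_comp1[OF d u f \<eta>] whisker_right_comp1[OF d u f \<theta>] \<eta>\<theta> by simp
    have g\<epsilon>: "id2 \<K> g \<star> \<epsilon> \<in> hom2 \<K> (g \<cdot> (u \<cdot> d)) ((g \<cdot> l) \<cdot> k)"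
      using whisker_left_in[OF ud g \<epsilon>] comp1_assoc[OF k l g] by simp
    have \<gamma>: "(g \<cdot> l, ?\<gamma>) \<in> Obj (LE \<K> (f \<cdot> (u \<cdot> d)) k)"
      using comp1_in[OF l g] vcomp_in[OF whisker_right_in[OF ud f \<eta>] g\<epsilon>]
      by (simp add: Obj_LE_iff[OF k fud])
    \<comment> \<open>The triangle that makes \<tau> at \<open>l\<close> a morphism is the exchange
      law for \<epsilon> and \<tau>.\<close>
    have mor: "\<tau> \<star> id2 \<K> l \<in> Hom (LE \<K> (f \<cdot> (u \<cdot> d)) k) (f \<cdot> l, id2 \<K> f \<star> \<epsilon>)
        (g \<cdot> l, (id2 \<K> g \<star> \<epsilon>) \<bullet> (\<tau> \<star> id2 \<K> (u \<cdot> d)))" if \<tau>: "\<tau> \<in> hom2 \<K> f g" for \<tau>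
      using whisker_right_in[OF l f \<tau>] whisker_right_comp1[OF k l f \<tau>]
        whisker_exchange[OF ud f \<epsilon> \<tau>] by (simp add: Hom_LE_iff)
    have "quotient_initial (LE \<K> (f \<cdot> (u \<cdot> d)) k) (f \<cdot> l, id2 \<K> f \<star> \<epsilon>)"
      using pres init unfolding preserves_quotient_initiality_of_left_kan_def
      by (auto simp: on_obj_push)
    then have "\<eta> \<star> id2 \<K> l = \<theta> \<star> id2 \<K> l"
      using \<gamma> mor[OF \<eta>] mor[OF \<theta>] unfolding \<eta>\<theta>d quotient_initial_def by blast
    from equ1[OF l this] obtain h where h: "h \<in> hom1 \<K> K e" "l = u \<cdot> h"
      and uniq: "\<And>h'. \<lbrakk>h' \<in> hom1 \<K> K e; l = u \<cdot> h'\<rbrakk> \<Longrightarrow> h' = h" by metis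
    have "\<exists>\<delta>\<in>hom2 \<K> d (h \<cdot> k). id2 \<K> u \<star> \<delta> = \<epsilon>"
      using full[OF d comp1_in[OF k h(1)]] \<epsilon> h(2) comp1_assoc[OF k h(1) u] by simp
    then show "\<exists>!h. h \<in> hom1 \<K> K e \<and> u \<cdot> h = l \<and> (\<exists>\<delta>\<in>hom2 \<K> d (h \<cdot> k). id2 \<K> u \<star> \<delta> = \<epsilon>)"
      using h(1) h(2)[symmetric] by (intro ex1I[of _ h] conjI) (simp_all add: uniq)
  next
    fix h \<delta> h' \<delta>' \<xi>
    assume "(h, \<delta>) \<in> Obj (LE \<K> d k)" "(h', \<delta>') \<in> Obj (LE \<K> d k)"
      and "\<xi> \<in> Hom (LE \<K> (u \<cdot> d) k) (u \<cdot> h, id2 \<K> u \<star> \<delta>) (u \<cdot> h', id2 \<K> u \<star> \<delta>')"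
    then show "\<exists>\<zeta>\<in>hom2 \<K> h h'. id2 \<K> u \<star> \<zeta> = \<xi>"
      using full[of h K h' \<xi>] by (simp add: Obj_LE_iff[OF k d] Hom_LE_iff)
  qed
qed

end

section \<open>Reversal of 2-cells\<close>

definition op_cat :: "('o, 'm) cat \<Rightarrow> ('o, 'm) cat" where
  "op_cat C = C\<lparr>Hom := (\<lambda>x y. Hom C y x), Comp := (\<lambda>g f. Comp C f g)\<rparr>"

lemma Obj_op_cat: "Obj (op_cat C) = Obj C"
  by (simp add: op_cat_def)

lemma prod_cat_op_cat: "prod_cat J (\<lambda>i. op_cat (D i)) = op_cat (prod_cat J D)"
  by (simp add: prod_cat_def op_cat_def)

lemma initial_obj_op_cat: "initial_obj (op_cat C) = terminal_obj C"
  by (simp add: fun_eq_iff initial_obj_def terminal_obj_def op_cat_def)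

lemma quotient_initial_op_cat: "quotient_initial (op_cat C) = subterminal C"
  by (simp add: fun_eq_iff quotient_initial_def subterminal_def op_cat_def)

text \<open>The dual K^co. The 1-cells keep their direction, which is why horizontal composition
  keeps the order of its arguments.\<close>

definition co :: "('o, 'a, 'b) two_cat \<Rightarrow> ('o, 'a, 'b) two_cat" where
  "co \<K> = \<K>\<lparr>dom2 := cod2 \<K>, cod2 := dom2 \<K>, vcomp := (\<lambda>\<beta> \<alpha>. vcomp \<K> \<alpha> \<beta>)\<rparr>"

lemma co_simps [simp]:
  "Cell0 (co \<K>) = Cell0 \<K>" "Cell1 (co \<K>) = Cell1 \<K>" "Cell2 (co \<K>) = Cell2 \<K>"
  "dom1 (co \<K>) = dom1 \<K>" "cod1 (co \<K>) = cod1 \<K>"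
  "dom2 (co \<K>) = cod2 \<K>" "cod2 (co \<K>) = dom2 \<K>"
  "id1 (co \<K>) = id1 \<K>" "id2 (co \<K>) = id2 \<K>"
  "comp1 (co \<K>) = comp1 \<K>" "hcomp (co \<K>) = hcomp \<K>"
  "vcomp (co \<K>) \<beta> \<alpha> = vcomp \<K> \<alpha> \<beta>"
  by (simp_all add: co_def)

lemma hom1_co [simp]: "hom1 (co \<K>) = hom1 \<K>"
  by (simp add: fun_eq_iff hom1_def)

lemma hom2_co [simp]: "hom2 (co \<K>) f g = hom2 \<K> g f"
  by (auto simp: hom2_def)

text \<open>The axioms for horizontal composition type the 2-cells by their sources. After reversal
  the known boundary is the original target, and \<open>hom2_dom_hom1\<close> carries the typing
  back to the original source.\<close>

lemma two_category_co:
  fixes \<K> :: "('o, 'a, 'b) two_cat" (structure)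
  assumes "two_category \<K>"
  shows "two_category (co \<K>)"
proof -
  interpret two_category \<K> by fact
  show ?thesis
  proof (rule two_category.intro, unfold co_simps hom1_co hom2_co)
    fix \<alpha> \<beta> f f' g g' x y z
    assume "f \<in> hom1 \<K> x y" "g \<in> hom1 \<K> y z" "\<alpha> \<in> hom2 \<K> f' f" "\<beta> \<in> hom2 \<K> g' g"
    then show "\<beta> \<star> \<alpha> \<in> hom2 \<K> (g' \<cdot> f') (g \<cdot> f)"
      by (meson hcomp_in hom2_dom_hom1)
  next
    fix \<alpha> f f' x y assume "f \<in> hom1 \<K> x y" "\<alpha> \<in> hom2 \<K> f' f"
    then show "\<alpha> \<star> id2 \<K> (id1 \<K> x) = \<alpha>" "id2 \<K> (id1 \<K> y) \<star> \<alpha> = \<alpha>"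
      by (meson hcomp_id2_id1 id2_id1_hcomp hom2_dom_hom1)+
  next
    fix \<alpha> \<beta> \<gamma> f f' g g' h h' w x y z
    assume "f \<in> hom1 \<K> w x" "g \<in> hom1 \<K> x y" "h \<in> hom1 \<K> y z"
      "\<alpha> \<in> hom2 \<K> f' f" "\<beta> \<in> hom2 \<K> g' g" "\<gamma> \<in> hom2 \<K> h' h"
    then show "\<gamma> \<star> (\<beta> \<star> \<alpha>) = (\<gamma> \<star> \<beta>) \<star> \<alpha>"
      by (meson hcomp_assoc hom2_dom_hom1)
  next
    fix \<alpha> \<alpha>' \<beta> \<beta>' f f' f'' g g' g'' x y z
    assume "f \<in> hom1 \<K> x y" "g \<in> hom1 \<K> y z" "\<alpha> \<in> hom2 \<K> f' f" "\<alpha>' \<in> hom2 \<K> f'' f'"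
      "\<beta> \<in> hom2 \<K> g' g" "\<beta>' \<in> hom2 \<K> g'' g'"
    then show "(\<beta> \<bullet> \<beta>') \<star> (\<alpha> \<bullet> \<alpha>') = (\<beta> \<star> \<alpha>) \<bullet> (\<beta>' \<star> \<alpha>')"
      by (meson interchange hom2_dom_hom1)
  next
    fix f x y assume "f \<in> hom1 \<K> x y"
    then show "f \<cdot> id1 \<K> x = f" "id1 \<K> y \<cdot> f = f"
      by (fact comp1_id1 id1_comp1)+
  qed (auto simp: dom1_in cod1_in dom2_in cod2_in dom1_cod2 cod1_cod2 id1_in id2_in
      vcomp_id2 id2_vcomp id2_hcomp_id2 comp1_in comp1_assoc vcomp_in vcomp_assoc)
qed

text \<open>A unit in the reversed 2-category is a counit in the original one, and the triangle
  conditions correspond; but the 2-cells between extensions run backwards, hence the opposite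
  category.\<close>

lemma LE_co: "LE (co \<K>) d k = op_cat (RE \<K> d k)"
  by (auto simp: LE_def RE_def op_cat_def fun_eq_iff)

lemma push_co: "push (co \<K>) = push \<K>"
  by (simp add: push_def fun_eq_iff)

lemma family_preserves_left_kan_co:
  "family_preserves_left_kan (co \<K>) J f d k = family_preserves_right_kan \<K> J f d k"
  by (simp add: family_preserves_left_kan_def family_preserves_right_kan_def
      preserves_initial_def preserves_terminal_def LE_co push_co initial_obj_op_cat)

lemma jointly_strictly_creates_left_kan_co:
  "jointly_strictly_creates_left_kan (co \<K>) J f d k = jointly_strictly_creates_right_kan \<K> J f d k"
  by (simp add: jointly_strictly_creates_left_kan_def jointly_strictly_creates_right_kan_def
      jointly_strictly_creates_initial_def jointly_strictly_creates_terminal_def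
      LE_co push_co prod_cat_op_cat initial_obj_op_cat Obj_op_cat)

lemma preserves_quotient_initiality_of_left_kan_co:
  "preserves_quotient_initiality_of_left_kan (co \<K>) f d k =
    preserves_subterminality_of_right_kan \<K> f d k"
  by (simp add: preserves_quotient_initiality_of_left_kan_def
      preserves_subterminality_of_right_kan_def LE_co push_co initial_obj_op_cat
      quotient_initial_op_cat)

section \<open>Universal properties under reversal\<close>

lemma is_product_co:
  assumes "is_product \<K> J cs c \<pi>"
  shows "is_product (co \<K>) J cs c \<pi>"
  using assms by (simp add: is_product_def)

text \<open>The structure 2-cell \<phi> now runs from \<open>g \<cdot> u\<close> to
  \<open>f \<cdot> u\<close>, so \<open>f\<close> and \<open>g\<close> trade places. This is why
  right Kan extensions ask for preservation by \<open>g\<close>.\<close>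

lemma is_inserter_co:
  fixes \<K> :: "('o, 'a, 'b) two_cat" (structure)
  assumes "is_inserter \<K> a b f g e u \<phi>"
  shows "is_inserter (co \<K>) a b g f e u \<phi>"
proof -
  note ins = assms[unfolded is_inserter_def]
  show ?thesis
    unfolding is_inserter_def co_simps hom1_co hom2_co
  proof (intro conjI)
    \<comment> \<open>Reversal exchanges the two 1-cells into the inserter and the two sides of the
      equation, so the original clause applies with \<open>h\<close> and \<open>h'\<close>
      swapped.\<close>
    show "\<forall>x\<in>Cell0 \<K>. \<forall>h\<in>hom1 \<K> x e. \<forall>h'\<in>hom1 \<K> x e. \<forall>\<alpha>'\<in>hom2 \<K> (u \<cdot> h') (u \<cdot> h).
        (\<phi> \<star> id2 \<K> h) \<bullet> (id2 \<K> f \<star> \<alpha>') = (id2 \<K> g \<star> \<alpha>') \<bullet> (\<phi> \<star> id2 \<K> h') \<longrightarrow>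
        (\<exists>!\<alpha>. \<alpha> \<in> hom2 \<K> h' h \<and> \<alpha>' = id2 \<K> u \<star> \<alpha>)"
      by (intro ballI impI, rule ins[THEN conjunct2, THEN conjunct2, THEN conjunct2,
            THEN conjunct2, THEN conjunct2, THEN conjunct2, rule_format]) (simp_all only:)
  qed (insert ins, (elim conjE, assumption)+)
qed

text \<open>Both 2-cells reverse, so \<open>f\<close> and \<open>g\<close> trade places; bijectivity
  on all hom-sets is unaffected by exchanging their endpoints.\<close>

lemma is_equifier_co:
  assumes "is_equifier \<K> c c' f g \<eta> \<theta> e u"
  shows "is_equifier (co \<K>) c c' g f \<eta> \<theta> e u"
  using assms
  by (simp add: is_equifier_def fully_faithful_def hom_cat_def postcomp_def)

section \<open>Left Kan extensions directly, right Kan extensions by reversal\<close>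

theorem theorem4p5:
  fixes \<K> :: "('o, 'a, 'b) two_cat"
  assumes "two_category \<K>"
  shows
    "(\<forall>(J :: 'i set) cs c \<pi>. is_product \<K> J cs c \<pi> \<longrightarrow>
        (\<forall>K I k d. k \<in> hom1 \<K> I K \<and> d \<in> hom1 \<K> I c \<longrightarrow>
          family_preserves_left_kan \<K> J \<pi> d k \<and>
          family_preserves_right_kan \<K> J \<pi> d k \<and>
          jointly_strictly_creates_left_kan \<K> J \<pi> d k \<and>
          jointly_strictly_creates_right_kan \<K> J \<pi> d k))
     \<and>
     (\<forall>a b f g e u \<phi>. is_inserter \<K> a b f g e u \<phi> \<longrightarrow>
        (\<forall>K I k d. k \<in> hom1 \<K> I K \<and> d \<in> hom1 \<K> I e \<longrightarrow>
          (preserves_left_kan \<K> f (u \<cdot>\<^bsub>\<K>\<^esub> d) k \<longrightarrow> strictly_creates_left_kan \<K> u d k) \<and>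
          (preserves_right_kan \<K> g (u \<cdot>\<^bsub>\<K>\<^esub> d) k \<longrightarrow> strictly_creates_right_kan \<K> u d k)))
     \<and>
     (\<forall>c c' f g \<eta> \<theta> e u. is_equifier \<K> c c' f g \<eta> \<theta> e u \<longrightarrow>
        (\<forall>K I k d. k \<in> hom1 \<K> I K \<and> d \<in> hom1 \<K> I e \<longrightarrow>
          (preserves_quotient_initiality_of_left_kan \<K> f (u \<cdot>\<^bsub>\<K>\<^esub> d) k \<longrightarrow>
             strictly_creates_left_kan \<K> u d k) \<and>
          (preserves_subterminality_of_right_kan \<K> g (u \<cdot>\<^bsub>\<K>\<^esub> d) k \<longrightarrow>
             strictly_creates_right_kan \<K> u d k)))"
proof -
  interpret two_category \<K> by fact
  note co = two_category_co[OF assms]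
  note creates_defs = strictly_creates_left_kan_def strictly_creates_right_kan_def
    preserves_left_kan_def preserves_right_kan_def
  show ?thesis
  proof (intro conjI allI impI; elim conjE)
    fix J :: "'i set" and cs c \<pi> K I k d
    assume *: "is_product \<K> J cs c \<pi>" "k \<in> hom1 \<K> I K" "d \<in> hom1 \<K> I c"
    \<comment> \<open>The left result in the reversed 2-category, rewritten by the translation
      lemmas, is the right result in the original one.\<close>
    note co_kan = two_category.product_left_kan[OF co is_product_co[OF *(1)], unfolded hom1_co,
        OF *(2,3), unfolded family_preserves_left_kan_co jointly_strictly_creates_left_kan_co]
    show "family_preserves_left_kan \<K> J \<pi> d k" "jointly_strictly_creates_left_kan \<K> J \<pi> d k"
      using product_left_kan[OF *] by simp_all
    show "family_preserves_right_kan \<K> J \<pi> d k" "jointly_strictly_creates_right_kan \<K> J \<pi> d k"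
      by (fact co_kan)+
  next
    fix a b f g e u \<phi> K I k d
    assume *: "is_inserter \<K> a b f g e u \<phi>" "k \<in> hom1 \<K> I K" "d \<in> hom1 \<K> I e"
    show "strictly_creates_left_kan \<K> u d k" if "preserves_left_kan \<K> f (u \<cdot>\<^bsub>\<K>\<^esub> d) k"
      using inserter_left_kan[OF * that] .
    \<comment> \<open>In the reversed 2-category \<open>g\<close> is the first of the two parallel
      1-cells, so preservation by \<open>g\<close> is what the left result asks for.\<close>
    show "strictly_creates_right_kan \<K> u d k" if "preserves_right_kan \<K> g (u \<cdot>\<^bsub>\<K>\<^esub> d) k"
      using two_category.inserter_left_kan[OF co is_inserter_co[OF *(1)], of k I K d] *(2,3) that
      by (simp add: creates_defs family_preserves_left_kan_co jointly_strictly_creates_left_kan_co)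
  next
    fix c c' f g \<eta> \<theta> e u K I k d
    assume *: "is_equifier \<K> c c' f g \<eta> \<theta> e u" "k \<in> hom1 \<K> I K" "d \<in> hom1 \<K> I e"
    show "strictly_creates_left_kan \<K> u d k"
      if "preserves_quotient_initiality_of_left_kan \<K> f (u \<cdot>\<^bsub>\<K>\<^esub> d) k"
      using equifier_left_kan[OF * that] .
    show "strictly_creates_right_kan \<K> u d k"
      if "preserves_subterminality_of_right_kan \<K> g (u \<cdot>\<^bsub>\<K>\<^esub> d) k"
      using two_category.equifier_left_kan[OF co is_equifier_co[OF *(1)], of k I K d] *(2,3) that
      by (simp add: creates_defs preserves_quotient_initiality_of_left_kan_co
          jointly_strictly_creates_left_kan_co)
  qed
qed

end
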